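(* Let $\mathcal X_i=\Delta^{d_i}$ for all $i$. Let $G$ be one of the following: (1) the $\alpha$-divergence $G(\pi_i,\sigma_i)=\frac{1}{\alpha(1-\alpha)}\big(1-\sum_{j=1}^{d_i}\pi_{ij}^{\alpha}\sigma_{ij}^{1-\alpha}\big)$ with $\alpha\in(0,1)$; (2) the Rényi divergence $G(\pi_i,\sigma_i)=\frac{1}{\alpha-1}\ln\big(\sum_{j=1}^{d_i}\pi_{ij}^{\alpha}\sigma_{ij}^{1-\alpha}\big)$ with $\alpha\in(0,1)$; (3) the reverse KL divergence $G(\pi_i,\sigma_i)=\mathrm{KL}(\sigma_i,\pi_i)=\sum_j\sigma_{ij}\ln(\sigma_{ij}/\pi_{ij})$. Fix $\mu>0$, let $\sigma^0$ lie in the interior of $\mathcal X$, and define $\sigma^{k+1}=\pi^{\mu,\sigma^k}$ for $k\ge0$. Then $\sigma^k$ converges to the set $\Pi^*$ of Nash equilibria, in the sense that $\min_{\pi^*\in\Pi^*}\mathrm{KL}(\pi^*,\sigma^k)\to0$ as $k\to\infty$.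
   Context: Game. Let $N\ge1$. $\Delta^d=\{p\in[0,1]^d:\sum_jp_j=1\}$ denotes the probability simplex, and $\mathcal X=\prod_i\mathcal X_i$. Each $v_i:\mathcal X\to\mathbb R$ is differentiable, with block gradient $\nabla_{\pi_i}v_i$. The game is monotone: $\sum_i\langle\nabla_{\pi_i}v_i(\pi)-\nabla_{\pi_i}v_i(\pi'),\pi_i-\pi_i'\rangle\le0$ for all $\pi,\pi'$. A Nash equilibrium is a $\pi^*$ with $v_i(\pi^* )\ge v_i(\pi_i,\pi^*_{-i})$ for all $i$ and $\pi_i\in\mathcal X_i$. $\Pi^*$ is the set of Nash equilibria. KL divergence: $\mathrm{KL}(\pi,\pi')=\sum_i\sum_j\pi_{ij}\ln(\pi_{ij}/\pi'_{ij})$. Perturbed equilibrium. For $\mu>0$ and $\sigma\in\mathcal X$, $\pi^{\mu,\sigma}$ is the profile with $\pi_i^{\mu,\sigma}\in\arg\max_{\pi_i\in\mathcal X_i}\{v_i(\pi_i,\pi^{\mu,\sigma}_{-i})-\mu G(\pi_i,\sigma_i)\}$ for all $i$. *)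

theory Defs
  imports "HOL-Analysis.Analysis"
begin

text \<open>Players are the elements of a finite type 'n; action labels come from a finite
  type 'a; player i uses the nonempty action set A i.  A strategy profile is a vector
  in real^('n \<times> 'a); coordinate (i,j) is the probability player i puts on action j,
  and coordinates (i,j) with j outside A i are 0.\<close>

type_synonym ('n,'a) profile = "real ^ ('n \<times> 'a)"

definition strat_space :: "('n::finite \<Rightarrow> 'a::finite set) \<Rightarrow> ('n,'a) profile set" where
  "strat_space A = {\<pi>. \<forall>i. (\<forall>j\<in>A i. 0 \<le> \<pi> $ (i,j)) \<and> (\<Sum>j\<in>A i. \<pi> $ (i,j)) = 1
                         \<and> (\<forall>j. j \<notin> A i \<longrightarrow> \<pi> $ (i,j) = 0)}"

definition strat_interior :: "('n::finite \<Rightarrow> 'a::finite set) \<Rightarrow> ('n,'a) profile set" where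
  "strat_interior A = {\<pi> \<in> strat_space A. \<forall>i. \<forall>j\<in>A i. 0 < \<pi> $ (i,j)}"

definition block :: "('n::finite,'a::finite) profile \<Rightarrow> 'n \<Rightarrow> 'a \<Rightarrow> real" where
  "block \<pi> i = (\<lambda>j. \<pi> $ (i,j))"

definition block_upd :: "'n \<Rightarrow> ('n::finite,'a::finite) profile \<Rightarrow> ('n,'a) profile \<Rightarrow> ('n,'a) profile" where
  "block_upd i p \<pi> = (\<chi> k. if fst k = i then p $ k else \<pi> $ k)"

definition nash_equilibria ::
  "('n::finite \<Rightarrow> 'a::finite set) \<Rightarrow> ('n \<Rightarrow> ('n,'a) profile \<Rightarrow> real) \<Rightarrow> ('n,'a) profile set" where
  "nash_equilibria A v = {\<pi>s \<in> strat_space A.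
      \<forall>i. \<forall>p\<in>strat_space A. v i (block_upd i p \<pi>s) \<le> v i \<pi>s}"

definition KL :: "('n::finite \<Rightarrow> 'a::finite set) \<Rightarrow> ('n,'a) profile \<Rightarrow> ('n,'a) profile \<Rightarrow> real" where
  "KL A \<pi> \<pi>' = (\<Sum>i\<in>UNIV. \<Sum>j\<in>A i. \<pi> $ (i,j) * ln (\<pi> $ (i,j) / \<pi>' $ (i,j)))"

text \<open>Divergences G(pi_i, sigma_i) on one simplex (action set B), valued in the extended
  reals so that infinite values are represented faithfully.\<close>

definition alpha_div :: "real \<Rightarrow> 'a set \<Rightarrow> ('a \<Rightarrow> real) \<Rightarrow> ('a \<Rightarrow> real) \<Rightarrow> ereal" where
  "alpha_div \<alpha> B p s =
     ereal (1 / (\<alpha> * (1 - \<alpha>)) * (1 - (\<Sum>j\<in>B. p j powr \<alpha> * s j powr (1 - \<alpha>))))"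

definition renyi_div :: "real \<Rightarrow> 'a set \<Rightarrow> ('a \<Rightarrow> real) \<Rightarrow> ('a \<Rightarrow> real) \<Rightarrow> ereal" where
  "renyi_div \<alpha> B p s =
     (let S = (\<Sum>j\<in>B. p j powr \<alpha> * s j powr (1 - \<alpha>))
      in if S = 0 then \<infinity> else ereal (1 / (\<alpha> - 1) * ln S))"

definition rev_KL :: "'a set \<Rightarrow> ('a \<Rightarrow> real) \<Rightarrow> ('a \<Rightarrow> real) \<Rightarrow> ereal" where
  "rev_KL B p s =
     (if \<exists>j\<in>B. 0 < s j \<and> p j = 0 then \<infinity>
      else ereal (\<Sum>j\<in>B. s j * ln (s j / p j)))"

definition perturbed_eq ::
  "('n::finite \<Rightarrow> 'a::finite set) \<Rightarrow> ('n \<Rightarrow> ('n,'a) profile \<Rightarrow> real)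
   \<Rightarrow> ('a set \<Rightarrow> ('a \<Rightarrow> real) \<Rightarrow> ('a \<Rightarrow> real) \<Rightarrow> ereal) \<Rightarrow> real
   \<Rightarrow> ('n,'a) profile \<Rightarrow> ('n,'a) profile \<Rightarrow> bool" where
  "perturbed_eq A v G \<mu> \<sigma> \<pi> \<longleftrightarrow> \<pi> \<in> strat_space A \<and>
     (\<forall>i. \<forall>p\<in>strat_space A.
        ereal (v i (block_upd i p \<pi>)) - ereal \<mu> * G (A i) (block p i) (block \<sigma> i)
        \<le> ereal (v i \<pi>) - ereal \<mu> * G (A i) (block \<pi> i) (block \<sigma> i))"

end

theory Submission
  imports Defs
begin

text \<open>
  Write \<open>u\<^sub>i\<^sub>j(\<pi>) = \<langle>\<nabla>\<^sub>i v\<^sub>i(\<pi>), e\<^sub>j - \<pi>\<^sub>i\<rangle>\<close> for the advantage of action \<open>j\<close>. For each of the three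
  divergences the one-sided optimality condition in direction \<open>e\<^sub>j - \<pi>\<^sub>i\<close> turns a perturbed equilibrium
  step \<open>\<sigma> \<mapsto> \<pi>\<close> into \<open>(\<sigma>\<^sub>i\<^sub>j / \<pi>\<^sub>i\<^sub>j) powr \<beta> \<le> 1 - \<kappa> u\<^sub>i\<^sub>j(\<pi>)\<close>, hence into an implicit replicator inequality
  \<open>ln \<pi>\<^sub>i\<^sub>j - ln \<sigma>\<^sub>i\<^sub>j \<ge> a u\<^sub>i\<^sub>j(\<pi>) + c u\<^sub>i\<^sub>j(\<pi>)\<^sup>2\<close>; everything else follows from this inequality.

  It bounds regrets, so a limit \<open>z\<close> of time averages of the iterates solves the Minty variational
  inequality. Then \<open>KL(z, \<sigma>\<^sup>k)\<close> decreases, which forces the advantages and the logarithmic increments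
  to vanish on the support \<open>J\<close> of \<open>z\<close>, and some cluster point \<open>s\<close> of the iterates has support exactly \<open>J\<close>.
  The equilibria may all lie on the boundary, so \<open>s\<close> need not be known to be Nash at this stage and
  \<open>KL(s, \<sigma>\<^sup>k)\<close> need not decrease. Its increase is however controlled by the actions \<open>e\<close> outside \<open>J\<close> with
  \<open>u\<^sub>e(s) > 0\<close>; near \<open>s\<close> their weights grow geometrically, so subtracting suitable multiples of these
  weights gives a local Lyapunov function. Together with \<open>\<Sum>\<^sub>e \<pi>\<^sub>e u\<^sub>e(\<pi>) = 0\<close> it traps the iterates near
  \<open>s\<close>. Thus \<open>\<sigma>\<^sup>k\<close> converges to \<open>s\<close>, an action with \<open>u\<^sub>e(s) > 0\<close> would grow forever, and so \<open>s\<close> is Nash.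
  The gradient need not be continuous: only lower semicontinuity of \<open>u\<close>, which comes from concavity
  of \<open>v\<^sub>i\<close> in the own strategy, is used.
\<close>

section \<open>Elementary inequalities\<close>

text \<open>The difference of the two sides has derivative
  \<open>y * (1 / (1 - y) - 1 / (1 + L))\<close>, whose second factor is nonnegative for
  \<open>- L \<le> y < 1\<close>; so the difference is smallest at 0, where it vanishes. The
  quadratic surplus later makes the divergence from a Minty solution decrease strictly.\<close>

lemma neg_ln_ge_quadratic:
  fixes x L :: real
  assumes "0 \<le> L" "- L \<le> x" "x < 1"
  shows "x + x\<^sup>2 / (2 * (1 + L)) \<le> - ln (1 - x)"
proof -
  define f where "f = (\<lambda>y. - ln (1 - y) - y - 1 / (2 * (1 + L)) * y\<^sup>2)"
  have der: "(f has_real_derivative y * (1 / (1 - y) - 1 / (1 + L))) (at y)" if "y < 1" for y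
  proof -
    have "(f has_real_derivative 1 / (1 - y) - 1 - 1 / (2 * (1 + L)) * (2 * y)) (at y)"
      unfolding f_def using that by (auto intro!: derivative_eq_intros simp: divide_inverse)
    moreover have "1 / (1 - y) - 1 - 1 / (2 * (1 + L)) * (2 * y) = y * (1 / (1 - y) - 1 / (1 + L))"
      using that assms(1) by (simp add: divide_simps) (simp add: algebra_simps)
    ultimately show ?thesis by simp
  qed
  have coef: "0 \<le> 1 / (1 - y) - 1 / (1 + L)" if "- L \<le> y" "y < 1" for y
    using that assms(1) frac_le[of 1 1 "1 - y" "1 + L"] by simp
  have f0: "f 0 = 0" by (simp add: f_def)
  have "0 \<le> f x"
  proof (cases "0 \<le> x")
    case True
    have "f 0 \<le> f x"
    proof (rule DERIV_nonneg_imp_nondecreasing[OF True])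
      fix y assume "0 \<le> y" "y \<le> x"
      then show "\<exists>d. (f has_real_derivative d) (at y) \<and> 0 \<le> d"
        using der[of y] coef[of y] assms
        by (intro exI[of _ "y * (1 / (1 - y) - 1 / (1 + L))"]) (auto intro!: mult_nonneg_nonneg)
    qed
    then show ?thesis using f0 by simp
  next
    case False
    then have "x \<le> 0" by simp
    have "f 0 \<le> f x"
    proof (rule DERIV_nonpos_imp_nonincreasing[OF \<open>x \<le> 0\<close>])
      fix y assume "x \<le> y" "y \<le> 0"
      then show "\<exists>d. (f has_real_derivative d) (at y) \<and> d \<le> 0"
        using der[of y] coef[of y] assms
        by (intro exI[of _ "y * (1 / (1 - y) - 1 / (1 + L))"]) (auto intro!: mult_nonpos_nonneg)
    qed
    then show ?thesis using f0 by simp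
  qed
  then show ?thesis by (simp add: f_def)
qed

text \<open>This is the previous bound with \<open>x = 1 - p / s\<close> and
  \<open>L = 1 / s - 1\<close>, multiplied by \<open>s\<close>; the condition
  \<open>- L \<le> x\<close> amounts to \<open>p \<le> 1\<close>. It lets a small relative entropy
  force small coordinate distances.\<close>

lemma relative_entropy_term_ge:
  fixes s p :: real
  assumes "0 < s" "s \<le> 1" "0 < p" "p \<le> 1"
  shows "(p - s)\<^sup>2 / 2 \<le> s * (ln s - ln p) - s + p"
proof -
  define x where "x = 1 - p / s"
  have "x + x\<^sup>2 / (2 * (1 + (1 / s - 1))) \<le> - ln (1 - x)"
    by (rule neg_ln_ge_quadratic) (use assms in \<open>auto simp: x_def field_simps\<close>)
  also have "- ln (1 - x) = ln s - ln p"
    using assms by (simp add: x_def ln_div)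
  finally have "s * (x + x\<^sup>2 / (2 * (1 + (1 / s - 1)))) \<le> s * (ln s - ln p)"
    using assms(1) by (intro mult_left_mono) auto
  moreover have "s * (x + x\<^sup>2 / (2 * (1 + (1 / s - 1)))) = s - p + (p - s)\<^sup>2 / 2"
    using assms(1) by (simp add: x_def field_simps power2_eq_square)
  ultimately show ?thesis by linarith
qed

text \<open>Equivalent to \<open>1 + x < exp x\<close>. The strictness leaves room for the
  perturbation \<open>\<delta>\<close> in the weights of the local Lyapunov function.\<close>

lemma exp_weight_bound:
  fixes x :: real
  assumes "0 < x"
  shows "x / (1 - exp (- x)) < 1 + x"
proof -
  have "1 + x < exp x"
    using ln_add_one_self_less_self[OF assms] assms
    by (metis add_pos_pos exp_less_mono exp_ln zero_less_one)
  then have "exp (- x) * (1 + x) < 1"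
    by (simp add: exp_minus field_simps)
  moreover have "exp (- x) < 1" using assms by simp
  ultimately show ?thesis by (simp add: field_simps)
qed

section \<open>Implicit replicator sequences\<close>

text \<open>The game reduced to what the dynamics uses: players disappear and only the total mass
  \<open>N\<close> remains. \<open>u_mono\<close> is monotonicity of the game rewritten in terms of
  advantages, and \<open>growth\<close> is the implicit replicator inequality, with \<open>u\<close>
  evaluated at the new iterate.\<close>

locale replicator_growth =
  fixes I :: "'e::finite set" and X :: "(real ^ 'e) set" and u :: "'e \<Rightarrow> real ^ 'e \<Rightarrow> real"
    and \<sigma> :: "nat \<Rightarrow> real ^ 'e" and a c N :: real
  assumes compact_X: "compact X" and convex_X: "convex X"
    and X_nonneg: "\<And>p e. p \<in> X \<Longrightarrow> 0 \<le> p $ e"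
    and X_le_1: "\<And>p e. p \<in> X \<Longrightarrow> p $ e \<le> 1"
    and X_off: "\<And>p e. p \<in> X \<Longrightarrow> e \<notin> I \<Longrightarrow> p $ e = 0"
    and X_mass: "\<And>p. p \<in> X \<Longrightarrow> (\<Sum>e\<in>I. p $ e) = N"
    and u_self: "\<And>p. p \<in> X \<Longrightarrow> (\<Sum>e\<in>I. p $ e * u e p) = 0"
    and u_mono: "\<And>p q. p \<in> X \<Longrightarrow> q \<in> X \<Longrightarrow>
                   0 \<le> (\<Sum>e\<in>I. q $ e * u e p) + (\<Sum>e\<in>I. p $ e * u e q)"
    and u_lsc: "\<And>p e \<epsilon>. p \<in> X \<Longrightarrow> e \<in> I \<Longrightarrow> 0 < \<epsilon> \<Longrightarrow>
                   \<exists>d>0. \<forall>q\<in>X. dist q p < d \<longrightarrow> u e p - \<epsilon> \<le> u e q"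
    and \<sigma>_in: "\<And>k. \<sigma> k \<in> X" and \<sigma>_pos: "\<And>k e. e \<in> I \<Longrightarrow> 0 < \<sigma> k $ e"
    and a_pos: "0 < a" and c_pos: "0 < c"
    and growth: "\<And>k e. e \<in> I \<Longrightarrow> a * u e (\<sigma> (Suc k)) + c * (u e (\<sigma> (Suc k)))\<^sup>2
                   \<le> ln (\<sigma> (Suc k) $ e) - ln (\<sigma> k $ e)"
begin

lemma ln_\<sigma>_nonpos: "e \<in> I \<Longrightarrow> ln (\<sigma> k $ e) \<le> 0"
  using \<sigma>_pos[of e k] X_le_1[OF \<sigma>_in, of k e] by simp

lemma growth_linear: "e \<in> I \<Longrightarrow> a * u e (\<sigma> (Suc k)) \<le> ln (\<sigma> (Suc k) $ e) - ln (\<sigma> k $ e)"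
  using growth[of e k] c_pos by (smt (verit) mult_nonneg_nonneg zero_le_power2)

section \<open>Regret bounds, time averages and the Minty inequality\<close>

text \<open>The growth inequality telescopes, and the final logarithm is at most 0 because weights
  never exceed 1; the bound is therefore uniform in \<open>n\<close>.\<close>

lemma regret_bound:
  assumes "e \<in> I"
  shows "a * (\<Sum>k<n. u e (\<sigma> (Suc k))) \<le> - ln (\<sigma> 0 $ e)"
proof -
  have "a * (\<Sum>k<n. u e (\<sigma> (Suc k))) \<le> (\<Sum>k<n. ln (\<sigma> (Suc k) $ e) - ln (\<sigma> k $ e))"
    unfolding sum_distrib_left by (intro sum_mono growth_linear assms)
  also have "\<dots> = ln (\<sigma> n $ e) - ln (\<sigma> 0 $ e)"
    by (rule sum_lessThan_telescope)
  finally show ?thesis using ln_\<sigma>_nonpos[OF assms, of n] by linarith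
qed

text \<open>The average starts at \<open>\<sigma> 1\<close> rather than \<open>\<sigma> 0\<close>,
  since \<open>growth\<close> speaks about the advantages at the new iterate.\<close>

definition avg :: "nat \<Rightarrow> real ^ 'e" where
  "avg n = (1 / real (Suc n)) *\<^sub>R (\<Sum>k<Suc n. \<sigma> (Suc k))"

lemma avg_in: "avg n \<in> X"
proof -
  have "(\<Sum>k<Suc n. (1 / real (Suc n)) *\<^sub>R \<sigma> (Suc k)) \<in> X"
    by (rule convex_sum) (use convex_X \<sigma>_in in auto)
  then show ?thesis by (simp add: avg_def scaleR_right.sum del: sum.lessThan_Suc)
qed

lemma avg_nth: "avg n $ e = (\<Sum>k<Suc n. \<sigma> (Suc k) $ e) / real (Suc n)"
  by (simp add: avg_def del: sum.lessThan_Suc)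

text \<open>Monotonicity trades the advantages at the iterates, weighted by \<open>p\<close>, for
  the advantages at \<open>p\<close>, weighted by the iterates. The former have bounded sums by
  \<open>regret_bound\<close>, so after averaging the error is of order
  \<open>1 / n\<close>.\<close>

lemma avg_minty:
  assumes p: "p \<in> X"
  shows "(\<Sum>e\<in>I. p $ e * ln (\<sigma> 0 $ e)) / (a * real (Suc n)) \<le> (\<Sum>e\<in>I. avg n $ e * u e p)"
proof -
  have "(\<Sum>k<Suc n. \<Sum>e\<in>I. \<sigma> (Suc k) $ e * u e p) \<ge> (\<Sum>k<Suc n. - (\<Sum>e\<in>I. p $ e * u e (\<sigma> (Suc k))))"
  proof (intro sum_mono)
    fix k
    show "- (\<Sum>e\<in>I. p $ e * u e (\<sigma> (Suc k))) \<le> (\<Sum>e\<in>I. \<sigma> (Suc k) $ e * u e p)"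
      using u_mono[OF \<sigma>_in p, of "Suc k"] by linarith
  qed
  moreover have "(\<Sum>k<Suc n. \<Sum>e\<in>I. p $ e * u e (\<sigma> (Suc k)))
      = (\<Sum>e\<in>I. p $ e * (\<Sum>k<Suc n. u e (\<sigma> (Suc k))))"
    unfolding sum_distrib_left by (rule sum.swap)
  moreover have "(\<Sum>e\<in>I. p $ e * (\<Sum>k<Suc n. u e (\<sigma> (Suc k))))
      \<le> (\<Sum>e\<in>I. p $ e * (- ln (\<sigma> 0 $ e) / a))"
  proof (intro sum_mono mult_left_mono X_nonneg p)
    fix e assume "e \<in> I"
    from regret_bound[OF this, of "Suc n"] a_pos
    show "(\<Sum>k<Suc n. u e (\<sigma> (Suc k))) \<le> - ln (\<sigma> 0 $ e) / a"
      by (simp add: field_simps del: sum.lessThan_Suc)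
  qed
  moreover have "(\<Sum>e\<in>I. p $ e * (- ln (\<sigma> 0 $ e) / a)) = - (\<Sum>e\<in>I. p $ e * ln (\<sigma> 0 $ e)) / a"
    by (simp add: sum_divide_distrib sum_negf)
  moreover have "(\<Sum>k<Suc n. \<Sum>e\<in>I. \<sigma> (Suc k) $ e * u e p)
      = real (Suc n) * (\<Sum>e\<in>I. avg n $ e * u e p)"
  proof -
    have "(\<Sum>k<Suc n. \<Sum>e\<in>I. \<sigma> (Suc k) $ e * u e p) = (\<Sum>e\<in>I. (\<Sum>k<Suc n. \<sigma> (Suc k) $ e) * u e p)"
      unfolding sum_distrib_right by (rule sum.swap)
    also have "\<dots> = (\<Sum>e\<in>I. real (Suc n) * (avg n $ e * u e p))"
      by (intro sum.cong refl) (simp add: avg_nth del: sum.lessThan_Suc of_nat_Suc)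
    finally show ?thesis by (simp add: sum_distrib_left)
  qed
  ultimately have "(\<Sum>e\<in>I. p $ e * ln (\<sigma> 0 $ e)) / a \<le> real (Suc n) * (\<Sum>e\<in>I. avg n $ e * u e p)"
    by (simp add: sum_negf del: sum.lessThan_Suc of_nat_Suc)
  then have "(\<Sum>e\<in>I. p $ e * ln (\<sigma> 0 $ e)) / a / real (Suc n) \<le> (\<Sum>e\<in>I. avg n $ e * u e p)"
    by (subst pos_divide_le_eq) (auto simp: mult.commute simp del: of_nat_Suc)
  then show ?thesis by simp
qed

lemma minty_solution_exists:
  obtains z \<rho> where "z \<in> X" "strict_mono \<rho>" "(avg \<circ> \<rho>) \<longlonglongrightarrow> z"
    "\<And>p. p \<in> X \<Longrightarrow> 0 \<le> (\<Sum>e\<in>I. z $ e * u e p)"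
proof -
  obtain z and \<rho> :: "nat \<Rightarrow> nat" where z: "z \<in> X" "strict_mono \<rho>" "(avg \<circ> \<rho>) \<longlonglongrightarrow> z"
    using compact_X avg_in unfolding compact_def by metis
  have "0 \<le> (\<Sum>e\<in>I. z $ e * u e p)" if p: "p \<in> X" for p
  proof (rule LIMSEQ_le)
    have "(\<lambda>n. (\<Sum>e\<in>I. p $ e * ln (\<sigma> 0 $ e)) / a * (1 / real (Suc n))) \<longlonglongrightarrow>
            (\<Sum>e\<in>I. p $ e * ln (\<sigma> 0 $ e)) / a * 0"
      by (intro tendsto_mult tendsto_const) (use LIMSEQ_inverse_real_of_nat in \<open>simp add: inverse_eq_divide\<close>)
    from LIMSEQ_subseq_LIMSEQ[OF this z(2)]
    show "((\<lambda>n. (\<Sum>e\<in>I. p $ e * ln (\<sigma> 0 $ e)) / (a * real (Suc n))) \<circ> \<rho>) \<longlonglongrightarrow> 0"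
      by (simp add: o_def)
    show "(\<lambda>n. \<Sum>e\<in>I. (avg \<circ> \<rho>) n $ e * u e p) \<longlonglongrightarrow> (\<Sum>e\<in>I. z $ e * u e p)"
      by (intro tendsto_sum tendsto_mult tendsto_const tendsto_vec_nth z(3))
    show "\<exists>M. \<forall>n\<ge>M. ((\<lambda>n. (\<Sum>e\<in>I. p $ e * ln (\<sigma> 0 $ e)) / (a * real (Suc n))) \<circ> \<rho>) n
             \<le> (\<Sum>e\<in>I. (avg \<circ> \<rho>) n $ e * u e p)"
      using avg_minty[OF p] by (simp del: of_nat_Suc)
  qed
  with z show ?thesis by (blast intro: that)
qed


section \<open>Behaviour on the support of a Minty solution\<close>

lemma minty_support_asymptotics:
  assumes z: "z \<in> X" and minty: "\<And>p. p \<in> X \<Longrightarrow> 0 \<le> (\<Sum>e\<in>I. z $ e * u e p)"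
    and e: "e \<in> I" "0 < z $ e"
  shows "(\<lambda>k. u e (\<sigma> (Suc k))) \<longlonglongrightarrow> 0"
    and "(\<lambda>k. ln (\<sigma> (Suc k) $ e) - ln (\<sigma> k $ e)) \<longlonglongrightarrow> 0"
    and "\<exists>l>0. \<forall>k. l \<le> \<sigma> k $ e"
proof -
  \<comment> \<open>Up to a constant, \<open>\<Phi> k\<close> is minus the divergence of
    \<open>\<sigma> k\<close> from \<open>z\<close>. The Minty inequality makes the linear part of
    its growth nonnegative, so each increment dominates the squared advantages; being bounded by 0,
    \<open>\<Phi>\<close> converges and its increments vanish.\<close>
  define \<Phi> where "\<Phi> = (\<lambda>k. \<Sum>e\<in>I. z $ e * ln (\<sigma> k $ e))"
  have step: "c * (\<Sum>e\<in>I. z $ e * (u e (\<sigma> (Suc k)))\<^sup>2) \<le> \<Phi> (Suc k) - \<Phi> k" for k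
  proof -
    have "a * (\<Sum>e\<in>I. z $ e * u e (\<sigma> (Suc k))) + c * (\<Sum>e\<in>I. z $ e * (u e (\<sigma> (Suc k)))\<^sup>2)
        = (\<Sum>e\<in>I. z $ e * (a * u e (\<sigma> (Suc k)) + c * (u e (\<sigma> (Suc k)))\<^sup>2))"
      by (simp add: sum_distrib_left sum.distrib algebra_simps)
    also have "\<dots> \<le> (\<Sum>e\<in>I. z $ e * (ln (\<sigma> (Suc k) $ e) - ln (\<sigma> k $ e)))"
      by (intro sum_mono mult_left_mono growth X_nonneg z)
    also have "\<dots> = \<Phi> (Suc k) - \<Phi> k"
      by (simp add: \<Phi>_def sum_subtractf right_diff_distrib)
    moreover have "0 \<le> a * (\<Sum>e\<in>I. z $ e * u e (\<sigma> (Suc k)))"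
      using a_pos minty[OF \<sigma>_in] by simp
    ultimately show ?thesis by linarith
  qed
  have sq_nonneg: "0 \<le> (\<Sum>e\<in>I. z $ e * (u e (\<sigma> (Suc k)))\<^sup>2)" for k
    by (intro sum_nonneg mult_nonneg_nonneg X_nonneg z) auto
  have inc: "\<Phi> k \<le> \<Phi> (Suc k)" for k
    using step[of k] mult_nonneg_nonneg[OF less_imp_le[OF c_pos] sq_nonneg[of k]] by linarith
  have le0: "\<Phi> k \<le> 0" for k
    unfolding \<Phi>_def by (intro sum_nonpos mult_nonneg_nonpos X_nonneg z ln_\<sigma>_nonpos)
  have mono: "incseq \<Phi>" using inc by (rule incseq_SucI)
  obtain l where l: "\<Phi> \<longlonglongrightarrow> l" using incseq_convergent[OF mono, of 0] le0 by blast
  have d0: "(\<lambda>k. \<Phi> (Suc k) - \<Phi> k) \<longlonglongrightarrow> 0"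
    using tendsto_diff[OF LIMSEQ_Suc[OF l] l] by simp
  have term_le: "c * (z $ f * (u f (\<sigma> (Suc k)))\<^sup>2) \<le> \<Phi> (Suc k) - \<Phi> k" if "f \<in> I" for f k
  proof -
    have "z $ f * (u f (\<sigma> (Suc k)))\<^sup>2 \<le> (\<Sum>e\<in>I. z $ e * (u e (\<sigma> (Suc k)))\<^sup>2)"
      by (rule member_le_sum) (use that z X_nonneg in auto)
    then show ?thesis using step[of k] c_pos by (smt (verit) mult_left_mono)
  qed
  have u0: "(\<lambda>k. u f (\<sigma> (Suc k))) \<longlonglongrightarrow> 0" if f: "f \<in> I" "0 < z $ f" for f
  proof -
    have "(\<lambda>k. (u f (\<sigma> (Suc k)))\<^sup>2) \<longlonglongrightarrow> 0"
    proof (rule tendsto_sandwich[OF _ _ tendsto_const])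
      show "(\<lambda>k. (\<Phi> (Suc k) - \<Phi> k) / (c * z $ f)) \<longlonglongrightarrow> 0"
        using tendsto_divide[OF d0 tendsto_const, of "c * z $ f"] c_pos f by simp
      show "\<forall>\<^sub>F k in sequentially. (u f (\<sigma> (Suc k)))\<^sup>2 \<le> (\<Phi> (Suc k) - \<Phi> k) / (c * z $ f)"
        using term_le[OF f(1)] c_pos f by (auto simp: field_simps)
    qed auto
    then show ?thesis by simp
  qed
  show "(\<lambda>k. u e (\<sigma> (Suc k))) \<longlonglongrightarrow> 0" by (rule u0[OF e])
  \<comment> \<open>Every weighted logarithmic increment is bounded below by a null sequence, and
    their sum tends to 0; hence each one is squeezed from above as well.\<close>
  show "(\<lambda>k. ln (\<sigma> (Suc k) $ e) - ln (\<sigma> k $ e)) \<longlonglongrightarrow> 0"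
  proof -
    define D where "D = (\<lambda>f k. ln (\<sigma> (Suc k) $ f) - ln (\<sigma> k $ f))"
    have Dsum: "\<Phi> (Suc k) - \<Phi> k = z $ e * D e k + (\<Sum>f\<in>I-{e}. z $ f * D f k)" for k
    proof -
      have "\<Phi> (Suc k) - \<Phi> k = (\<Sum>f\<in>I. z $ f * D f k)"
        by (simp add: \<Phi>_def D_def sum_subtractf right_diff_distrib)
      then show ?thesis using e by (simp add: sum.remove)
    qed
    have lower: "z $ f * (a * u f (\<sigma> (Suc k))) \<le> z $ f * D f k" if "f \<in> I" for f k
      unfolding D_def by (intro mult_left_mono growth_linear X_nonneg z that)
    have zu0: "(\<lambda>k. z $ f * (a * u f (\<sigma> (Suc k)))) \<longlonglongrightarrow> 0" if "f \<in> I" for f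
    proof (cases "z $ f = 0")
      case False
      then have "0 < z $ f" using X_nonneg[OF z, of f] by simp
      from u0[OF that this] show ?thesis by (auto intro!: tendsto_eq_intros)
    qed simp
    have "(\<lambda>k. z $ e * D e k) \<longlonglongrightarrow> 0"
    proof (rule tendsto_sandwich)
      show "(\<lambda>k. z $ e * (a * u e (\<sigma> (Suc k)))) \<longlonglongrightarrow> 0" by (rule zu0[OF e(1)])
      show "\<forall>\<^sub>F k in sequentially. z $ e * (a * u e (\<sigma> (Suc k))) \<le> z $ e * D e k"
        using lower[OF e(1)] by simp
      have "(\<lambda>k. (\<Phi> (Suc k) - \<Phi> k) - (\<Sum>f\<in>I-{e}. z $ f * (a * u f (\<sigma> (Suc k))))) \<longlonglongrightarrow> 0 - (\<Sum>f\<in>I-{e}. 0)"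
        by (intro tendsto_diff tendsto_sum d0 zu0) auto
      then show "(\<lambda>k. (\<Phi> (Suc k) - \<Phi> k) - (\<Sum>f\<in>I-{e}. z $ f * (a * u f (\<sigma> (Suc k))))) \<longlonglongrightarrow> 0"
        by simp
      have "(\<Sum>f\<in>I-{e}. z $ f * (a * u f (\<sigma> (Suc k)))) \<le> (\<Sum>f\<in>I-{e}. z $ f * D f k)" for k
        by (intro sum_mono lower) auto
      then show "\<forall>\<^sub>F k in sequentially. z $ e * D e k \<le>
          (\<Phi> (Suc k) - \<Phi> k) - (\<Sum>f\<in>I-{e}. z $ f * (a * u f (\<sigma> (Suc k))))"
        by (intro always_eventually allI) (subst Dsum, simp)
    qed
    from tendsto_divide[OF this tendsto_const, of "z $ e"] e
    show ?thesis by (simp add: D_def)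
  qed
  \<comment> \<open>All other terms of \<open>\<Phi> k\<close> are nonpositive, so
    \<open>\<Phi> 0 \<le> \<Phi> k\<close> bounds the single term at \<open>e\<close> from
    below.\<close>
  show "\<exists>l>0. \<forall>k. l \<le> \<sigma> k $ e"
  proof (intro exI[of _ "exp (\<Phi> 0 / z $ e)"] conjI allI)
    fix k
    have "\<Phi> k = z $ e * ln (\<sigma> k $ e) + (\<Sum>f\<in>I-{e}. z $ f * ln (\<sigma> k $ f))"
      unfolding \<Phi>_def using e by (simp add: sum.remove)
    moreover have "(\<Sum>f\<in>I-{e}. z $ f * ln (\<sigma> k $ f)) \<le> 0"
      by (intro sum_nonpos mult_nonneg_nonpos X_nonneg z ln_\<sigma>_nonpos) auto
    moreover have "\<Phi> 0 \<le> \<Phi> k" using mono by (simp add: incseq_def)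
    ultimately have "\<Phi> 0 / z $ e \<le> ln (\<sigma> k $ e)" using e by (simp add: field_simps)
    then have "exp (\<Phi> 0 / z $ e) \<le> exp (ln (\<sigma> k $ e))" by simp
    then show "exp (\<Phi> 0 / z $ e) \<le> \<sigma> k $ e" using \<sigma>_pos[OF e(1), of k] by simp
  qed auto
qed

text \<open>Time averages put no mass outside the support of their limit \<open>z\<close>, so neither do the iterates
  along a suitable subsequence.\<close>

lemma cluster_point_on_minty_support:
  assumes z: "z \<in> X" and minty: "\<And>p. p \<in> X \<Longrightarrow> 0 \<le> (\<Sum>e\<in>I. z $ e * u e p)"
    and \<rho>: "strict_mono \<rho>" "(avg \<circ> \<rho>) \<longlonglongrightarrow> z"
  obtains s r where "s \<in> X" "strict_mono r" "(\<sigma> \<circ> r) \<longlonglongrightarrow> s"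
    "\<And>e. e \<in> I \<Longrightarrow> 0 < s $ e \<longleftrightarrow> 0 < z $ e"
proof -
  \<comment> \<open>Here \<open>J\<close> is the complement of the support of \<open>z\<close>, and
    \<open>m\<close> is the mass placed on it.\<close>
  define J where "J = {e \<in> I. z $ e = 0}"
  define m where "m = (\<lambda>p::real ^ 'e. \<Sum>e\<in>J. p $ e)"
  have m_nonneg: "0 \<le> m (\<sigma> k)" for k
    unfolding m_def by (intro sum_nonneg X_nonneg \<sigma>_in)
  \<comment> \<open>If the mass stayed at least \<open>\<epsilon>\<close> after time
    \<open>n\<close>, the averages would carry mass at least \<open>\<epsilon>\<close> minus a term
    of order \<open>1 / j\<close>, whereas their limit \<open>z\<close> carries none.\<close>
  have freq: "\<exists>k>n. m (\<sigma> k) < \<epsilon>" if "0 < \<epsilon>" for n \<epsilon>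
  proof (rule ccontr)
    assume "\<not> ?thesis"
    then have big: "\<epsilon> \<le> m (\<sigma> k)" if "n < k" for k using that by force
    have avg_m: "m (avg j) = (\<Sum>k<Suc j. m (\<sigma> (Suc k))) / real (Suc j)" for j
      unfolding m_def avg_nth sum_divide_distrib[symmetric] by (subst sum.swap) simp
    have lower: "\<epsilon> - \<epsilon> * real n * (1 / real (Suc j)) \<le> m (avg j)" for j
    proof -
      have "\<epsilon> * (real (Suc j) - real n) \<le> (\<Sum>k<Suc j. m (\<sigma> (Suc k)))"
      proof (cases "n \<le> Suc j")
        case True
        have "\<epsilon> * (real (Suc j) - real n) = (\<Sum>k\<in>{n..<Suc j}. \<epsilon>)"
          using True by (simp add: of_nat_diff)
        also have "\<dots> \<le> (\<Sum>k\<in>{n..<Suc j}. m (\<sigma> (Suc k)))"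
          by (intro sum_mono big) auto
        also have "\<dots> \<le> (\<Sum>k<Suc j. m (\<sigma> (Suc k)))"
          by (intro sum_mono2) (use m_nonneg in auto)
        finally show ?thesis .
      next
        case False
        then have "\<epsilon> * (real (Suc j) - real n) \<le> 0"
          using that by (intro mult_nonneg_nonpos) auto
        also have "0 \<le> (\<Sum>k<Suc j. m (\<sigma> (Suc k)))" by (intro sum_nonneg m_nonneg)
        finally show ?thesis .
      qed
      then have "\<epsilon> * (real (Suc j) - real n) / real (Suc j) \<le> m (avg j)"
        unfolding avg_m by (intro divide_right_mono) auto
      moreover have "\<epsilon> * (real (Suc j) - real n) / real (Suc j) = \<epsilon> - \<epsilon> * real n * (1 / real (Suc j))"
        by (simp add: field_simps del: of_nat_Suc)
      ultimately show ?thesis by simp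
    qed
    have "(\<lambda>j. \<epsilon> - \<epsilon> * real n * (1 / real (Suc j))) \<longlonglongrightarrow> \<epsilon> - \<epsilon> * real n * 0"
      by (intro tendsto_intros) (use LIMSEQ_inverse_real_of_nat in \<open>simp add: inverse_eq_divide\<close>)
    from LIMSEQ_subseq_LIMSEQ[OF this \<rho>(1)]
    have 1: "((\<lambda>j. \<epsilon> - \<epsilon> * real n * (1 / real (Suc j))) \<circ> \<rho>) \<longlonglongrightarrow> \<epsilon>" by simp
    have 2: "(\<lambda>j. m ((avg \<circ> \<rho>) j)) \<longlonglongrightarrow> m z"
      unfolding m_def by (intro tendsto_sum tendsto_vec_nth \<rho>(2))
    have "\<epsilon> \<le> m z"
      by (rule LIMSEQ_le[OF 1 2]) (use lower in auto)
    moreover have "m z = 0" by (simp add: m_def J_def)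
    ultimately show False using that by simp
  qed
  \<comment> \<open>Recursive choice of increasing times \<open>q n\<close> at which the mass off
    the support is below \<open>1 / (n + 1)\<close>.\<close>
  define q where "q = rec_nat (SOME k. m (\<sigma> k) < 1) (\<lambda>n k. SOME k'. k' > k \<and> m (\<sigma> k') < inverse (real (Suc (Suc n))))"
  have q0: "m (\<sigma> (q 0)) < 1" unfolding q_def using someI_ex[of "\<lambda>k. m (\<sigma> k) < 1"] freq[of 1] by auto
  have qS: "q (Suc n) > q n \<and> m (\<sigma> (q (Suc n))) < inverse (real (Suc (Suc n)))" for n
    unfolding q_def using someI_ex[OF freq[of "inverse (real (Suc (Suc n)))" "q n"]] by (simp add: q_def del: of_nat_Suc)
  have q_mono: "strict_mono q" using qS by (simp add: strict_mono_Suc_iff)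
  have q_small: "m (\<sigma> (q n)) \<le> inverse (real (Suc n))" for n
  proof (cases n)
    case 0
    then show ?thesis using q0 by simp
  next
    case (Suc j)
    then show ?thesis using qS[of j] by (simp del: of_nat_Suc)
  qed
  have m0: "(\<lambda>n. m (\<sigma> (q n))) \<longlonglongrightarrow> 0"
    by (rule tendsto_sandwich[OF _ _ tendsto_const LIMSEQ_inverse_real_of_nat]) (use q_small m_nonneg in auto)
  obtain s and t :: "nat \<Rightarrow> nat" where s: "s \<in> X" "strict_mono t" "((\<sigma> \<circ> q) \<circ> t) \<longlonglongrightarrow> s"
    using compact_X \<sigma>_in unfolding compact_def by (metis comp_apply)
  have ms: "m s = 0"
  proof (rule LIMSEQ_unique)
    show "(\<lambda>n. m (((\<sigma> \<circ> q) \<circ> t) n)) \<longlonglongrightarrow> m s"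
      unfolding m_def by (intro tendsto_sum tendsto_vec_nth s(3))
    show "(\<lambda>n. m (((\<sigma> \<circ> q) \<circ> t) n)) \<longlonglongrightarrow> 0"
      using LIMSEQ_subseq_LIMSEQ[OF m0 s(2)] by (simp add: o_def)
  qed
  \<comment> \<open>The limit has no mass where \<open>z\<close> vanishes because
    \<open>m s = 0\<close>; conversely, weights on the support of \<open>z\<close> stay bounded away
    from 0 along the whole sequence.\<close>
  have "0 < s $ e \<longleftrightarrow> 0 < z $ e" if e: "e \<in> I" for e
  proof
    assume pos: "0 < s $ e"
    have "z $ e \<noteq> 0"
    proof
      assume "z $ e = 0"
      then have "e \<in> J" using e by (simp add: J_def)
      then have "s $ e = 0" using ms X_nonneg[OF s(1)] unfolding m_def by (simp add: sum_nonneg_eq_0_iff)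
      with pos show False by simp
    qed
    then show "0 < z $ e" using X_nonneg[OF z, of e] by simp
  next
    assume "0 < z $ e"
    from minty_support_asymptotics(3)[OF z minty e this]
    obtain l where l: "0 < l" "\<And>k. l \<le> \<sigma> k $ e" by blast
    have "l \<le> s $ e"
      by (rule LIMSEQ_le_const[OF tendsto_vec_nth[OF s(3)]]) (use l in auto)
    then show "0 < s $ e" using l by simp
  qed
  moreover have "strict_mono (q \<circ> t)" using q_mono s(2) by (rule strict_mono_o)
  ultimately show ?thesis using s by (intro that[of s "q \<circ> t"]) (auto simp: o_assoc)
qed


section \<open>Trapping the iterates near a cluster point\<close>

text \<open>Actions split into the support \<open>J\<close> of \<open>s\<close>, the actions
  \<open>P\<close> with positive advantage at \<open>s\<close>, and the rest \<open>R\<close>. Three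
  facts combine: \<open>V\<close> does not increase while the new iterate is near \<open>s\<close>,
  it controls the divergence \<open>E\<close> from \<open>s\<close> up to vanishing terms, and steps
  on \<open>J\<close> become too short to leave the neighbourhood in one move.\<close>

lemma trapped_near_cluster_point:
  assumes s: "s \<in> X" and r: "strict_mono r" "(\<sigma> \<circ> r) \<longlonglongrightarrow> s"
    and u_tendsto: "\<And>e. e \<in> I \<Longrightarrow> 0 < s $ e \<Longrightarrow> (\<lambda>k. u e (\<sigma> (Suc k))) \<longlonglongrightarrow> 0"
    and ln_tendsto: "\<And>e. e \<in> I \<Longrightarrow> 0 < s $ e \<Longrightarrow>
                       (\<lambda>k. ln (\<sigma> (Suc k) $ e) - ln (\<sigma> k $ e)) \<longlonglongrightarrow> 0"
  shows "\<sigma> \<longlonglongrightarrow> s"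
proof -
  define \<phi> where "\<phi> = (\<lambda>e. u e s)"
  define J where "J = {e \<in> I. 0 < s $ e}"
  define P where "P = {e \<in> I. 0 < \<phi> e}"
  have s_zero: "s $ e = 0" if "e \<notin> J" for e
    using that X_nonneg[OF s, of e] X_off[OF s, of e] by (cases "e \<in> I") (auto simp: J_def)
  \<comment> \<open>A positive value would persist near \<open>s\<close> by lower semicontinuity,
    yet the advantages on \<open>J\<close> tend to 0 along the subsequence \<open>r\<close>.\<close>
  have \<phi>_nonpos: "\<phi> e \<le> 0" if "e \<in> J" for e
  proof (rule ccontr)
    assume "\<not> \<phi> e \<le> 0"
    then have pos: "0 < \<phi> e / 2" by simp
    have e: "e \<in> I" "0 < s $ e" using that by (auto simp: J_def)
    obtain d where d: "d > 0" "\<And>q. q \<in> X \<Longrightarrow> dist q s < d \<Longrightarrow> u e s - \<phi> e / 2 \<le> u e q"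
      using u_lsc[OF s e(1) pos] by blast
    have "(\<lambda>k. u e (\<sigma> k)) \<longlonglongrightarrow> 0" using u_tendsto[OF e] by (rule LIMSEQ_imp_Suc)
    from LIMSEQ_subseq_LIMSEQ[OF this r(1)] have lim: "(\<lambda>n. u e (\<sigma> (r n))) \<longlonglongrightarrow> 0" by (simp add: o_def)
    obtain n0 where "\<And>n. n \<ge> n0 \<Longrightarrow> dist (\<sigma> (r n)) s < d"
      using r(2) d(1) unfolding lim_sequentially by auto
    then have "\<phi> e / 2 \<le> u e (\<sigma> (r n))" if "n \<ge> n0" for n
      using d(2)[OF \<sigma>_in, of "r n"] that by (simp add: \<phi>_def)
    then have "\<phi> e / 2 \<le> 0" by (intro LIMSEQ_le_const[OF lim]) auto
    with pos show False by simp
  qed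
  \<comment> \<open>Complementary slackness: by \<open>u_self\<close> the products
    \<open>s $ e * \<phi> e\<close> sum to 0, and none of them is positive.\<close>
  have \<phi>_zero: "\<phi> e = 0" if e: "e \<in> J" for e
  proof -
    have "(\<Sum>e\<in>I. - (s $ e * \<phi> e)) = 0" using u_self[OF s] by (simp add: sum_negf \<phi>_def)
    moreover have "0 \<le> - (s $ f * \<phi> f)" if "f \<in> I" for f
      using \<phi>_nonpos[of f] X_nonneg[OF s, of f] s_zero[of f]
      by (cases "f \<in> J") (auto simp: mult_nonneg_nonpos)
    ultimately have "\<forall>e\<in>I. - (s $ e * \<phi> e) = 0"
      by (subst (asm) sum_nonneg_eq_0_iff) auto
    then show ?thesis using e by (fastforce simp: J_def)
  qed
  have s_zero_P: "s $ e = 0" if "e \<in> P" for e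
    using that s_zero[of e] \<phi>_zero[of e] by (auto simp: P_def)
  define R where "R = I - J - P"
  have I_split: "(\<Sum>e\<in>I. h e) = (\<Sum>e\<in>J. h e) + (\<Sum>e\<in>P. h e) + (\<Sum>e\<in>R. h e)" for h :: "'e \<Rightarrow> real"
  proof -
    have "P \<inter> J = {}" using \<phi>_zero by (fastforce simp: P_def)
    moreover have "I = (J \<union> P) \<union> R" "(J \<union> P) \<inter> R = {}" by (auto simp: R_def J_def P_def)
    ultimately show ?thesis by (metis finite inf_commute sum.union_disjoint)
  qed
  have \<phi>_R: "\<phi> e \<le> 0" if "e \<in> R" for e using that by (auto simp: R_def P_def)
  have PI: "P \<subseteq> I" and RI: "R \<subseteq> I" and JI: "J \<subseteq> I" by (auto simp: P_def R_def J_def)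

  \<comment> \<open>At \<open>\<delta> = 0\<close> the strict inequality is
    \<open>exp_weight_bound\<close> with \<open>x = a * \<phi> e\<close>, so by continuity it
    survives for small \<open>\<delta>\<close>. The condition \<open>\<delta> < \<phi> e\<close>
    keeps actions of \<open>P\<close> growing near \<open>s\<close>, and
    \<open>\<delta> < 1 / a\<close> lets the mass on \<open>R\<close> absorb the error
    there.\<close>
  have "\<forall>\<^sub>F \<delta> in at_right 0. \<forall>e\<in>P. a * \<phi> e / (1 - exp (- (a * (\<phi> e - \<delta>)))) < 1 + a * (\<phi> e - \<delta>) \<and> \<delta> < \<phi> e"
  proof (intro eventually_ball_finite ballI eventually_conj)
    fix e assume "e \<in> P"
    then have pos: "0 < \<phi> e" by (simp add: P_def)
    have "((\<lambda>\<delta>. 1 + a * (\<phi> e - \<delta>) - a * \<phi> e / (1 - exp (- (a * (\<phi> e - \<delta>))))) \<longlongrightarrow>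
             1 + a * (\<phi> e - 0) - a * \<phi> e / (1 - exp (- (a * (\<phi> e - 0))))) (at_right 0)"
      using a_pos pos by (intro tendsto_intros) auto
    moreover have "0 < 1 + a * (\<phi> e - 0) - a * \<phi> e / (1 - exp (- (a * (\<phi> e - 0))))"
      using exp_weight_bound[of "a * \<phi> e"] a_pos pos by simp
    ultimately have "\<forall>\<^sub>F \<delta> in at_right 0. 0 < 1 + a * (\<phi> e - \<delta>) - a * \<phi> e / (1 - exp (- (a * (\<phi> e - \<delta>))))"
      by (rule order_tendstoD)
    then show "\<forall>\<^sub>F \<delta> in at_right 0. a * \<phi> e / (1 - exp (- (a * (\<phi> e - \<delta>)))) < 1 + a * (\<phi> e - \<delta>)"
      by simp
    show "\<forall>\<^sub>F \<delta> in at_right 0. \<delta> < \<phi> e"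
      using pos by (auto simp: eventually_at_right_field)
  qed simp
  moreover have "\<forall>\<^sub>F \<delta> in at_right 0. 0 < \<delta> \<and> \<delta> < 1 / a"
    using a_pos by (auto simp: eventually_at_right_field intro!: exI[of _ "1 / a"])
  ultimately have "\<forall>\<^sub>F \<delta> in at_right 0. (\<forall>e\<in>P. a * \<phi> e / (1 - exp (- (a * (\<phi> e - \<delta>)))) < 1 + a * (\<phi> e - \<delta>) \<and> \<delta> < \<phi> e)
      \<and> 0 < \<delta> \<and> \<delta> < 1 / a"
    by (rule eventually_conj)
  then obtain \<delta> where \<delta>: "0 < \<delta>" "\<delta> < 1 / a"
    "\<And>e. e \<in> P \<Longrightarrow> a * \<phi> e / (1 - exp (- (a * (\<phi> e - \<delta>)))) < 1 + a * (\<phi> e - \<delta>)"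
    "\<And>e. e \<in> P \<Longrightarrow> \<delta> < \<phi> e"
    using eventually_happens[of _ "at_right (0::real)"] trivial_limit_at_right_real by blast
  \<comment> \<open>\<open>C e\<close> is the weight for which one step's gain of coordinate \<open>e\<close> pays for its contribution \<open>a * \<phi> e * q $ e\<close>
    to the divergence from \<open>s\<close>; it exceeds \<open>1\<close> by less than \<open>a * (\<phi> e - \<delta>)\<close>, which \<open>u_self\<close> can absorb.\<close>
  define C where "C = (\<lambda>e. a * \<phi> e / (1 - exp (- (a * (\<phi> e - \<delta>)))))"

  have "\<forall>\<^sub>F q in nhds s. \<forall>e\<in>I. q \<in> X \<longrightarrow> \<phi> e - \<delta> \<le> u e q"
  proof (intro eventually_ball_finite ballI)
    fix e assume "e \<in> I"
    then show "\<forall>\<^sub>F q in nhds s. q \<in> X \<longrightarrow> \<phi> e - \<delta> \<le> u e q"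
      using u_lsc[OF s _ \<delta>(1)] unfolding eventually_nhds_metric \<phi>_def by blast
  qed simp
  \<comment> \<open>As \<open>I\<close> is finite, one radius \<open>d\<close> serves all actions:
    within it no advantage falls more than \<open>\<delta>\<close> below its value at
    \<open>s\<close>.\<close>
  then obtain d where d: "0 < d" "\<And>q e. q \<in> X \<Longrightarrow> dist q s < d \<Longrightarrow> e \<in> I \<Longrightarrow> \<phi> e - \<delta> \<le> u e q"
    unfolding eventually_nhds_metric by blast

  \<comment> \<open>Only the support is measured: since total mass is fixed, the mass outside
    \<open>J\<close> equals what \<open>J\<close> has lost, so the full distance is at most
    \<open>2 * D q\<close>.\<close>
  define D where "D = (\<lambda>q::real ^ 'e. \<Sum>e\<in>J. \<bar>q $ e - s $ e\<bar>)"
  have out_mass: "(\<Sum>e\<in>P. q $ e) + (\<Sum>e\<in>R. q $ e) = (\<Sum>e\<in>J. s $ e - q $ e)" if "q \<in> X" for q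
  proof -
    have "(\<Sum>e\<in>P. s $ e) = 0" "(\<Sum>e\<in>R. s $ e) = 0"
      using s_zero_P s_zero by (auto intro!: sum.neutral simp: R_def)
    then show ?thesis
      using X_mass[OF that] X_mass[OF s] unfolding I_split by (simp add: sum_subtractf)
  qed
  have dist_le: "dist q s \<le> 2 * D q" if q: "q \<in> X" for q
  proof -
    have "dist q s \<le> (\<Sum>e\<in>UNIV. \<bar>(q - s) $ e\<bar>)" unfolding dist_norm by (rule norm_le_l1_cart)
    also have "\<dots> = (\<Sum>e\<in>I. \<bar>(q - s) $ e\<bar>)"
      using X_off[OF q] X_off[OF s] by (intro sum.mono_neutral_right) auto
    also have "\<dots> = D q + ((\<Sum>e\<in>P. q $ e) + (\<Sum>e\<in>R. q $ e))"
    proof -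
      have "(\<Sum>e\<in>P. \<bar>(q - s) $ e\<bar>) = (\<Sum>e\<in>P. q $ e)"
        using s_zero_P X_nonneg[OF q] by (intro sum.cong refl) simp
      moreover have "(\<Sum>e\<in>R. \<bar>(q - s) $ e\<bar>) = (\<Sum>e\<in>R. q $ e)"
        using s_zero X_nonneg[OF q] by (intro sum.cong refl) (auto simp: R_def)
      ultimately show ?thesis unfolding I_split by (simp add: D_def)
    qed
    also have "\<dots> \<le> D q + D q"
      unfolding out_mass[OF q] D_def by (intro add_left_mono sum_mono) auto
    finally show ?thesis by simp
  qed

  \<comment> \<open>\<open>K\<close> is the divergence of \<open>q\<close> from \<open>s\<close>,
    and \<open>E\<close> is its Bregman form with nonnegative terms; they differ by the mass of
    \<open>q\<close> outside \<open>J\<close>. \<open>B\<close> is the loss caused by actions with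
    negative advantage at \<open>s\<close>.\<close>
  define E where "E = (\<lambda>q. \<Sum>e\<in>J. s $ e * (ln (s $ e) - ln (q $ e)) - s $ e + q $ e)"
  define K where "K = (\<lambda>q. \<Sum>e\<in>J. s $ e * (ln (s $ e) - ln (q $ e)))"
  define B where "B = (\<lambda>q::real ^ 'e. \<Sum>e\<in>R. - \<phi> e * q $ e)"
  define V where "V = (\<lambda>q. K q - (\<Sum>e\<in>P. C e * q $ e))"
  have C_pos: "0 < C e" if "e \<in> P" for e
    using that a_pos \<delta>(4)[OF that] \<delta>(1) unfolding C_def P_def by (auto intro!: divide_pos_pos)
  have B_nonneg: "0 \<le> B q" if "q \<in> X" for q
    unfolding B_def by (intro sum_nonneg mult_nonneg_nonneg X_nonneg that) (use \<phi>_R in auto)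

  \<comment> \<open>Monotonicity between the new iterate and \<open>s\<close> bounds the increase of
    \<open>K\<close> by \<open>a\<close> times the advantages at \<open>s\<close> weighted by the
    iterate: a harmful part on \<open>P\<close> and the helpful part \<open>- B\<close>. Near
    \<open>s\<close>, the weight of \<open>e\<close> in \<open>P\<close> grows at least by the
    factor \<open>exp (a * (\<phi> e - \<delta>))\<close>, and \<open>C e\<close> is scaled so that
    this gain covers the harmful part.\<close>
  have V_step: "V (\<sigma> (Suc k)) + a * B (\<sigma> (Suc k)) \<le> V (\<sigma> k)" if near: "dist (\<sigma> (Suc k)) s < d" for k
  proof -
    let ?q = "\<sigma> (Suc k)"
    have "K ?q - K (\<sigma> k) = - (\<Sum>e\<in>J. s $ e * (ln (?q $ e) - ln (\<sigma> k $ e)))"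
      by (simp add: K_def sum_subtractf[symmetric] sum_negf[symmetric] algebra_simps)
    also have "\<dots> \<le> - (\<Sum>e\<in>J. s $ e * (a * u e ?q))"
      by (intro le_imp_neg_le sum_mono mult_left_mono growth_linear X_nonneg s) (auto simp: J_def)
    also have "(\<Sum>e\<in>J. s $ e * (a * u e ?q)) = (\<Sum>e\<in>I. s $ e * (a * u e ?q))"
      using s_zero JI by (intro sum.mono_neutral_left) auto
    also have "(\<Sum>e\<in>I. s $ e * (a * u e ?q)) = a * (\<Sum>e\<in>I. s $ e * u e ?q)"
      by (simp add: sum_distrib_left algebra_simps)
    also have "- (a * (\<Sum>e\<in>I. s $ e * u e ?q)) \<le> a * (\<Sum>e\<in>I. ?q $ e * \<phi> e)"
      using u_mono[OF \<sigma>_in s, of "Suc k"] a_pos unfolding \<phi>_def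
      by (smt (verit) mult_left_mono mult_minus_right)
    also have "(\<Sum>e\<in>I. ?q $ e * \<phi> e) = (\<Sum>e\<in>P. ?q $ e * \<phi> e) - B ?q"
      unfolding I_split using \<phi>_zero by (simp add: B_def sum_negf mult.commute)
    finally have 1: "K ?q - K (\<sigma> k) \<le> a * (\<Sum>e\<in>P. ?q $ e * \<phi> e) - a * B ?q"
      by (simp add: right_diff_distrib)
    have "a * (\<Sum>e\<in>P. ?q $ e * \<phi> e) \<le> (\<Sum>e\<in>P. C e * ?q $ e) - (\<Sum>e\<in>P. C e * \<sigma> k $ e)"
      unfolding sum_distrib_left sum_subtractf[symmetric]
    proof (rule sum_mono)
      fix e assume e: "e \<in> P"
      then have eI: "e \<in> I" using PI by auto
      have "a * (\<phi> e - \<delta>) \<le> ln (?q $ e) - ln (\<sigma> k $ e)"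
        using growth_linear[OF eI, of k] d(2)[OF \<sigma>_in near eI] a_pos
        by (smt (verit) mult_left_mono)
      then have "exp (ln (\<sigma> k $ e)) \<le> exp (ln (?q $ e) + - (a * (\<phi> e - \<delta>)))" by simp
      then have le: "\<sigma> k $ e \<le> ?q $ e * exp (- (a * (\<phi> e - \<delta>)))"
        using \<sigma>_pos[OF eI] unfolding exp_add by simp
      have x1: "exp (- (a * (\<phi> e - \<delta>))) < 1" using a_pos \<delta>(4)[OF e] by simp
      have "C e * (1 - exp (- (a * (\<phi> e - \<delta>)))) = a * \<phi> e"
        using x1 unfolding C_def by (subst nonzero_eq_divide_eq[symmetric]) auto
      then have "a * (?q $ e * \<phi> e) = C e * (1 - exp (- (a * (\<phi> e - \<delta>)))) * ?q $ e"
        by simp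
      also have "\<dots> = C e * (?q $ e - ?q $ e * exp (- (a * (\<phi> e - \<delta>))))"
        by (simp only: right_diff_distrib left_diff_distrib mult_1_right mult_1 mult.assoc mult.commute[of "exp _"])
      also have "\<dots> \<le> C e * (?q $ e - \<sigma> k $ e)"
        using C_pos[OF e] le by (intro mult_left_mono) auto
      finally show "a * (?q $ e * \<phi> e) \<le> C e * ?q $ e - C e * \<sigma> k $ e"
        by (simp add: right_diff_distrib)
    qed
    with 1 show ?thesis unfolding V_def by linarith
  qed

  \<comment> \<open>Passing from \<open>V\<close> to \<open>E\<close> adds
    \<open>C e * q $ e\<close> on \<open>P\<close> and subtracts the mass outside \<open>J\<close>.
    Since \<open>C e < 1 + a * (\<phi> e - \<delta>)\<close>, the mass on \<open>P\<close> cancels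
    the 1; the remainder is bounded through \<open>u_self\<close>, which balances the gains on
    \<open>P\<close> against the terms on \<open>J\<close> and \<open>R\<close>. The leftover
    \<open>a * \<delta>\<close> times the mass on \<open>R\<close> is at most that mass, which is
    subtracted too.\<close>
  have E_le: "E q \<le> V q + a * B q + a * (\<Sum>e\<in>J. \<bar>u e q\<bar>)" if q: "q \<in> X" and near: "dist q s < d" for q
  proof -
    have "(\<Sum>e\<in>P. (\<phi> e - \<delta>) * q $ e) \<le> (\<Sum>e\<in>P. q $ e * u e q)"
      using d(2)[OF q near] PI X_nonneg[OF q]
      by (intro sum_mono) (subst mult.commute, auto intro!: mult_left_mono)
    also have "\<dots> = - (\<Sum>e\<in>J. q $ e * u e q) + - (\<Sum>e\<in>R. q $ e * u e q)"
      using u_self[OF q] unfolding I_split by linarith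
    also have "- (\<Sum>e\<in>J. q $ e * u e q) \<le> (\<Sum>e\<in>J. \<bar>u e q\<bar>)"
      unfolding sum_negf[symmetric]
    proof (rule sum_mono)
      fix e
      have "- (q $ e * u e q) \<le> \<bar>q $ e\<bar> * \<bar>u e q\<bar>" by (metis abs_ge_minus_self abs_mult)
      also have "\<dots> \<le> 1 * \<bar>u e q\<bar>"
        using X_nonneg[OF q, of e] X_le_1[OF q, of e] by (intro mult_right_mono) auto
      finally show "- (q $ e * u e q) \<le> \<bar>u e q\<bar>" by simp
    qed
    also have "- (\<Sum>e\<in>R. q $ e * u e q) \<le> (\<Sum>e\<in>R. - \<phi> e * q $ e + \<delta> * q $ e)"
      unfolding sum_negf[symmetric]
    proof (rule sum_mono)
      fix e assume "e \<in> R"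
      then have "\<phi> e - \<delta> \<le> u e q" using d(2)[OF q near] RI by auto
      then have "q $ e * (\<phi> e - \<delta>) \<le> q $ e * u e q" by (intro mult_left_mono X_nonneg q)
      then show "- (q $ e * u e q) \<le> - \<phi> e * q $ e + \<delta> * q $ e" by (simp add: algebra_simps)
    qed
    also have "(\<Sum>e\<in>R. - \<phi> e * q $ e + \<delta> * q $ e) = B q + \<delta> * (\<Sum>e\<in>R. q $ e)"
      unfolding B_def sum_distrib_left sum.distrib ..
    finally have "(\<Sum>e\<in>P. (\<phi> e - \<delta>) * q $ e) \<le> (\<Sum>e\<in>J. \<bar>u e q\<bar>) + (B q + \<delta> * (\<Sum>e\<in>R. q $ e))"
      by simp
    then have "a * (\<Sum>e\<in>P. (\<phi> e - \<delta>) * q $ e)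
        \<le> a * ((\<Sum>e\<in>J. \<bar>u e q\<bar>) + (B q + \<delta> * (\<Sum>e\<in>R. q $ e)))"
      using a_pos by (intro mult_left_mono) auto
    then have 1: "a * (\<Sum>e\<in>P. (\<phi> e - \<delta>) * q $ e)
        \<le> a * (\<Sum>e\<in>J. \<bar>u e q\<bar>) + a * B q + (a * \<delta>) * (\<Sum>e\<in>R. q $ e)"
      by (simp add: algebra_simps)
    have "(a * \<delta>) * (\<Sum>e\<in>R. q $ e) \<le> 1 * (\<Sum>e\<in>R. q $ e)"
      using \<delta>(2) a_pos by (intro mult_right_mono sum_nonneg X_nonneg q) (simp add: field_simps)
    with 1 have 2: "a * (\<Sum>e\<in>P. (\<phi> e - \<delta>) * q $ e)
        \<le> a * (\<Sum>e\<in>J. \<bar>u e q\<bar>) + a * B q + (\<Sum>e\<in>R. q $ e)" by simp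
    have "(\<Sum>e\<in>P. C e * q $ e) \<le> (\<Sum>e\<in>P. q $ e + a * ((\<phi> e - \<delta>) * q $ e))"
    proof (rule sum_mono)
      fix e assume "e \<in> P"
      then have "C e * q $ e \<le> (1 + a * (\<phi> e - \<delta>)) * q $ e"
        using \<delta>(3) by (intro mult_right_mono X_nonneg q) (auto simp: C_def intro: less_imp_le)
      then show "C e * q $ e \<le> q $ e + a * ((\<phi> e - \<delta>) * q $ e)" by (simp add: algebra_simps)
    qed
    also have "\<dots> = (\<Sum>e\<in>P. q $ e) + a * (\<Sum>e\<in>P. (\<phi> e - \<delta>) * q $ e)"
      by (simp add: sum.distrib sum_distrib_left)
    finally have 3: "(\<Sum>e\<in>P. C e * q $ e) \<le> (\<Sum>e\<in>P. q $ e) + a * (\<Sum>e\<in>P. (\<phi> e - \<delta>) * q $ e)" .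
    have "E q = K q - (\<Sum>e\<in>J. s $ e - q $ e)"
      unfolding E_def K_def sum_subtractf[symmetric] by (intro sum.cong) auto
    then have "E q = V q + (\<Sum>e\<in>P. C e * q $ e) - (\<Sum>e\<in>P. q $ e) - (\<Sum>e\<in>R. q $ e)"
      using out_mass[OF q] unfolding V_def by simp
    with 2 3 show ?thesis by linarith
  qed

  \<comment> \<open>Each coordinate error is at most \<open>\<rho>\<close> divided by
    \<open>card J + 1\<close>, so the sum over \<open>J\<close> is strictly below
    \<open>\<rho>\<close>.\<close>
  have D_small: "D (\<sigma> k) < \<rho>" if "0 < \<rho>" "E (\<sigma> k) < (\<rho> / real (Suc (card J)))\<^sup>2 / 2" for \<rho> k
  proof -
    have "\<bar>\<sigma> k $ e - s $ e\<bar> \<le> \<rho> / real (Suc (card J))" if e: "e \<in> J" for e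
    proof -
      have t: "(\<sigma> k $ f - s $ f)\<^sup>2 / 2 \<le> s $ f * (ln (s $ f) - ln (\<sigma> k $ f)) - s $ f + \<sigma> k $ f"
        if "f \<in> J" for f
        by (rule relative_entropy_term_ge) (use that \<sigma>_pos X_le_1 s \<sigma>_in in \<open>auto simp: J_def\<close>)
      have "(\<sigma> k $ e - s $ e)\<^sup>2 / 2 \<le> E (\<sigma> k)"
      proof -
        have "(\<sigma> k $ e - s $ e)\<^sup>2 / 2 \<le> (\<Sum>f\<in>J. (\<sigma> k $ f - s $ f)\<^sup>2 / 2)"
          using e by (intro member_le_sum) auto
        also have "\<dots> \<le> E (\<sigma> k)" unfolding E_def by (intro sum_mono t)
        finally show ?thesis .
      qed
      then have "\<bar>\<sigma> k $ e - s $ e\<bar>\<^sup>2 \<le> (\<rho> / real (Suc (card J)))\<^sup>2"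
        using \<open>E (\<sigma> k) < _\<close> by simp
      then show ?thesis by (rule power2_le_imp_le) (use \<open>0 < \<rho>\<close> in auto)
    qed
    then have "D (\<sigma> k) \<le> real (card J) * (\<rho> / real (Suc (card J)))"
      unfolding D_def by (intro sum_bounded_above) auto
    also have "\<dots> < \<rho>" using \<open>0 < \<rho>\<close> by (simp add: field_simps)
    finally show ?thesis .
  qed

  have ev_u: "(\<lambda>k. a * (\<Sum>e\<in>J. \<bar>u e (\<sigma> (Suc k))\<bar>)) \<longlonglongrightarrow> 0"
  proof -
    have "(\<lambda>k. a * (\<Sum>e\<in>J. \<bar>u e (\<sigma> (Suc k))\<bar>)) \<longlonglongrightarrow> a * (\<Sum>e\<in>J. \<bar>0\<bar>)"
      by (intro tendsto_intros u_tendsto) (auto simp: J_def)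
    then show ?thesis by simp
  qed
  have ev_step: "(\<lambda>k. \<Sum>e\<in>J. \<bar>\<sigma> (Suc k) $ e - \<sigma> k $ e\<bar>) \<longlonglongrightarrow> 0"
  proof -
    have "(\<lambda>k. \<bar>\<sigma> (Suc k) $ e - \<sigma> k $ e\<bar>) \<longlonglongrightarrow> 0" if e: "e \<in> J" for e
    proof (rule tendsto_sandwich[OF _ _ tendsto_const])
      have eI: "e \<in> I" "0 < s $ e" using e by (auto simp: J_def)
      have "(\<lambda>k. \<bar>exp (ln (\<sigma> (Suc k) $ e) - ln (\<sigma> k $ e)) - 1\<bar>) \<longlonglongrightarrow> \<bar>exp 0 - 1\<bar>"
        by (intro tendsto_intros ln_tendsto eI)
      then show "(\<lambda>k. \<bar>exp (ln (\<sigma> (Suc k) $ e) - ln (\<sigma> k $ e)) - 1\<bar>) \<longlonglongrightarrow> 0" by simp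
      have "\<bar>\<sigma> (Suc k) $ e - \<sigma> k $ e\<bar> \<le> \<bar>exp (ln (\<sigma> (Suc k) $ e) - ln (\<sigma> k $ e)) - 1\<bar>" for k
      proof -
        have "\<sigma> (Suc k) $ e - \<sigma> k $ e = \<sigma> k $ e * (exp (ln (\<sigma> (Suc k) $ e) - ln (\<sigma> k $ e)) - 1)"
          using \<sigma>_pos[OF eI(1), of k] \<sigma>_pos[OF eI(1), of "Suc k"] by (simp add: exp_diff field_simps)
        then have "\<bar>\<sigma> (Suc k) $ e - \<sigma> k $ e\<bar> = \<sigma> k $ e * \<bar>exp (ln (\<sigma> (Suc k) $ e) - ln (\<sigma> k $ e)) - 1\<bar>"
          using \<sigma>_pos[OF eI(1), of k] by (simp add: abs_mult)
        also have "\<dots> \<le> 1 * \<bar>exp (ln (\<sigma> (Suc k) $ e) - ln (\<sigma> k $ e)) - 1\<bar>"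
          by (intro mult_right_mono X_le_1 \<sigma>_in) auto
        finally show ?thesis by simp
      qed
      then show "\<forall>\<^sub>F k in sequentially. \<bar>\<sigma> (Suc k) $ e - \<sigma> k $ e\<bar>
          \<le> \<bar>exp (ln (\<sigma> (Suc k) $ e) - ln (\<sigma> k $ e)) - 1\<bar>" by simp
    qed auto
    then have "(\<lambda>k. \<Sum>e\<in>J. \<bar>\<sigma> (Suc k) $ e - \<sigma> k $ e\<bar>) \<longlonglongrightarrow> (\<Sum>e\<in>J. 0)" by (intro tendsto_sum)
    then show ?thesis by simp
  qed
  have ev_K: "(\<lambda>n. K (\<sigma> (r n))) \<longlonglongrightarrow> 0"
  proof -
    have "(\<lambda>n. K ((\<sigma> \<circ> r) n)) \<longlonglongrightarrow> K s"
      unfolding K_def by (intro tendsto_intros r(2)) (auto simp: J_def)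
    then show ?thesis by (simp add: K_def)
  qed
  have ev_D: "(\<lambda>n. D (\<sigma> (r n))) \<longlonglongrightarrow> 0"
  proof -
    have "(\<lambda>n. D ((\<sigma> \<circ> r) n)) \<longlonglongrightarrow> D s"
      unfolding D_def by (intro tendsto_intros r(2))
    then show ?thesis by (simp add: D_def)
  qed

  \<comment> \<open>Entering at a late time of the subsequence, the invariant is
    \<open>D < \<rho>\<close> and \<open>V < \<tau> / 2\<close>. One step keeps \<open>D\<close>
    below \<open>d / 4 + \<rho> \<le> d / 2\<close>, hence the new iterate within distance
    \<open>d\<close>; then \<open>V_step\<close> and \<open>E_le\<close> give
    \<open>E < \<tau>\<close>, and \<open>D_small\<close> restores
    \<open>D < \<rho>\<close>.\<close>
  have trap: "\<exists>M. \<forall>k\<ge>M. D (\<sigma> k) < \<rho>" if \<rho>: "0 < \<rho>" "\<rho> \<le> d / 4" for \<rho>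
  proof -
    define \<tau> where "\<tau> = (\<rho> / real (Suc (card J)))\<^sup>2 / 2"
    have \<tau>: "0 < \<tau> / 2" using \<rho>(1) by (simp add: \<tau>_def)
    have "\<forall>\<^sub>F k in sequentially. a * (\<Sum>e\<in>J. \<bar>u e (\<sigma> (Suc k))\<bar>) < \<tau> / 2
        \<and> (\<Sum>e\<in>J. \<bar>\<sigma> (Suc k) $ e - \<sigma> k $ e\<bar>) < d / 4"
      using order_tendstoD(2)[OF ev_u \<tau>] order_tendstoD(2)[OF ev_step, of "d / 4"] d(1)
      by (intro eventually_conj) auto
    then obtain M0 where M0: "\<And>k. k \<ge> M0 \<Longrightarrow> a * (\<Sum>e\<in>J. \<bar>u e (\<sigma> (Suc k))\<bar>) < \<tau> / 2"
      "\<And>k. k \<ge> M0 \<Longrightarrow> (\<Sum>e\<in>J. \<bar>\<sigma> (Suc k) $ e - \<sigma> k $ e\<bar>) < d / 4"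
      unfolding eventually_sequentially by blast
    have "\<forall>\<^sub>F n in sequentially. (K (\<sigma> (r n)) < \<tau> / 2 \<and> D (\<sigma> (r n)) < \<rho>) \<and> M0 \<le> n"
      using order_tendstoD(2)[OF ev_K \<tau>] order_tendstoD(2)[OF ev_D \<rho>(1)]
      by (intro eventually_conj eventually_ge_at_top)
    then obtain n where n: "K (\<sigma> (r n)) < \<tau> / 2" "D (\<sigma> (r n)) < \<rho>" "M0 \<le> n"
      using eventually_happens'[OF sequentially_bot] by blast
    have M: "M0 \<le> r n" using n(3) seq_suble[OF r(1), of n] by linarith
    have "D (\<sigma> k) < \<rho> \<and> V (\<sigma> k) < \<tau> / 2" if "k \<ge> r n" for k
      using that
    proof (induction k rule: dec_induct)
      case base
      have "0 \<le> (\<Sum>e\<in>P. C e * \<sigma> (r n) $ e)"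
        by (intro sum_nonneg mult_nonneg_nonneg X_nonneg \<sigma>_in less_imp_le[OF C_pos])
      then show ?case using n unfolding V_def by simp
    next
      case (step k)
      have "D (\<sigma> (Suc k)) \<le> (\<Sum>e\<in>J. \<bar>\<sigma> (Suc k) $ e - \<sigma> k $ e\<bar> + \<bar>\<sigma> k $ e - s $ e\<bar>)"
        unfolding D_def by (intro sum_mono) linarith
      also have "\<dots> < d / 4 + \<rho>"
        using M0(2)[of k] step M by (simp add: sum.distrib D_def)
      finally have "2 * D (\<sigma> (Suc k)) < d" using \<rho>(2) by simp
      then have near: "dist (\<sigma> (Suc k)) s < d" using dist_le[OF \<sigma>_in, of "Suc k"] by linarith
      have V: "V (\<sigma> (Suc k)) + a * B (\<sigma> (Suc k)) < \<tau> / 2" using V_step[OF near] step by linarith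
      have "E (\<sigma> (Suc k)) < \<tau>"
        using E_le[OF \<sigma>_in near] V M0(1)[of k] step M by simp
      then have "D (\<sigma> (Suc k)) < \<rho>" unfolding \<tau>_def by (rule D_small[OF \<rho>(1)])
      moreover have "0 \<le> a * B (\<sigma> (Suc k))" using a_pos B_nonneg[OF \<sigma>_in] by simp
      ultimately show ?case using V by linarith
    qed
    then show ?thesis by blast
  qed
  show ?thesis
    unfolding lim_sequentially
  proof (intro allI impI)
    fix \<epsilon> :: real assume "0 < \<epsilon>"
    then have "0 < min (\<epsilon> / 2) (d / 4)" using d(1) by simp
    then obtain M where M: "\<And>k. k \<ge> M \<Longrightarrow> D (\<sigma> k) < min (\<epsilon> / 2) (d / 4)"
      using trap[OF _ min.cobounded2] by blast
    have "dist (\<sigma> k) s < \<epsilon>" if "k \<ge> M" for k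
      using dist_le[OF \<sigma>_in, of k] M[OF that] by linarith
    then show "\<exists>M. \<forall>k\<ge>M. dist (\<sigma> k) s < \<epsilon>" by blast
  qed
qed

text \<open>A positive advantage at the limit would persist along the tail, making the logarithm of
  that weight grow at least linearly, although it never exceeds 0.\<close>

lemma limit_nonpos:
  assumes s: "s \<in> X" and lim: "\<sigma> \<longlonglongrightarrow> s" and e: "e \<in> I"
  shows "u e s \<le> 0"
proof (rule ccontr)
  assume "\<not> ?thesis"
  then have pos: "0 < u e s / 2" by simp
  obtain d where d: "d > 0" "\<And>q. q \<in> X \<Longrightarrow> dist q s < d \<Longrightarrow> u e s - u e s / 2 \<le> u e q"
    using u_lsc[OF s e pos] by blast
  obtain M where M: "\<And>k. k \<ge> M \<Longrightarrow> dist (\<sigma> k) s < d"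
    using lim d(1) unfolding lim_sequentially by blast
  have step: "a * (u e s / 2) \<le> ln (\<sigma> (Suc k) $ e) - ln (\<sigma> k $ e)" if "k \<ge> M" for k
    using growth_linear[OF e, of k] d(2)[OF \<sigma>_in M[of "Suc k"]] a_pos that
    by (smt (verit) field_sum_of_halves le_SucI mult_left_mono)
  have lin: "ln (\<sigma> M $ e) + real n * (a * (u e s / 2)) \<le> ln (\<sigma> (M + n) $ e)" for n
  proof (induction n)
    case (Suc n)
    have "real (Suc n) * (a * (u e s / 2)) = real n * (a * (u e s / 2)) + a * (u e s / 2)"
      by (simp only: of_nat_Suc distrib_right mult_1)
    moreover have "a * (u e s / 2) \<le> ln (\<sigma> (M + Suc n) $ e) - ln (\<sigma> (M + n) $ e)"
      using step[of "M + n"] by simp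
    ultimately show ?case using Suc by linarith
  qed simp
  obtain n :: nat where "- ln (\<sigma> M $ e) < real n * (a * (u e s / 2))"
    using reals_Archimedean3[OF mult_pos_pos[OF a_pos pos]] by blast
  then show False using lin[of n] ln_\<sigma>_nonpos[OF e, of "M + n"] by linarith
qed

theorem converges_to_rest_point:
  obtains s where "s \<in> X" "\<sigma> \<longlonglongrightarrow> s" "\<And>e. e \<in> I \<Longrightarrow> u e s \<le> 0"
proof -
  obtain z \<rho> where z: "z \<in> X" "strict_mono \<rho>" "(avg \<circ> \<rho>) \<longlonglongrightarrow> z"
    and minty: "\<And>p. p \<in> X \<Longrightarrow> 0 \<le> (\<Sum>e\<in>I. z $ e * u e p)"
    using minty_solution_exists by blast
  obtain s r where s: "s \<in> X" "strict_mono r" "(\<sigma> \<circ> r) \<longlonglongrightarrow> s"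
    and supp: "\<And>e. e \<in> I \<Longrightarrow> 0 < s $ e \<longleftrightarrow> 0 < z $ e"
    using cluster_point_on_minty_support[OF z(1) minty z(2,3)] by blast
  have "\<sigma> \<longlonglongrightarrow> s"
    by (rule trapped_near_cluster_point[OF s])
       (use minty_support_asymptotics(1,2)[OF z(1) minty] supp in auto)
  then show ?thesis using that s(1) limit_nonpos by blast
qed

end

section \<open>Monotone games on products of simplices\<close>

lemma strat_space_nonneg: "p \<in> strat_space A \<Longrightarrow> 0 \<le> p $ e"
  by (cases e; cases "snd e \<in> A (fst e)") (auto simp: strat_space_def)

lemma strat_space_le_1:
  assumes "p \<in> strat_space A"
  shows "p $ e \<le> 1"
proof (cases "snd e \<in> A (fst e)")
  case True
  have "p $ (fst e, snd e) \<le> (\<Sum>j\<in>A (fst e). p $ (fst e, j))"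
    by (rule member_le_sum) (use True strat_space_nonneg[OF assms] in auto)
  then show ?thesis using assms by (simp add: strat_space_def)
next
  case False
  then show ?thesis using assms by (cases e) (auto simp: strat_space_def)
qed

lemma convex_strat_space:
  fixes A :: "'n::finite \<Rightarrow> 'a::finite set"
  shows "convex (strat_space A)"
proof (rule convexI)
  fix x y :: "('n, 'a) profile" and s t :: real
  assume "x \<in> strat_space A" "y \<in> strat_space A" "0 \<le> s" "0 \<le> t" "s + t = 1"
  then show "s *\<^sub>R x + t *\<^sub>R y \<in> strat_space A"
    by (simp add: strat_space_def sum.distrib sum_distrib_left[symmetric])
qed

lemma compact_strat_space:
  fixes A :: "'n::finite \<Rightarrow> 'a::finite set"
  shows "compact (strat_space A)"
proof (rule compact_eq_bounded_closed[THEN iffD2, OF conjI])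
  show "bounded (strat_space A)"
    unfolding bounded_iff
  proof (intro exI ballI)
    fix p assume p: "p \<in> strat_space A"
    have "norm p \<le> (\<Sum>e\<in>UNIV. \<bar>p $ e\<bar>)" by (rule norm_le_l1_cart)
    also have "\<dots> \<le> (\<Sum>e\<in>(UNIV :: ('n \<times> 'a) set). 1)"
      using strat_space_nonneg[OF p] strat_space_le_1[OF p] by (intro sum_mono) auto
    finally show "norm p \<le> (\<Sum>e\<in>(UNIV :: ('n \<times> 'a) set). 1)" .
  qed
  show "closed (strat_space A)"
  proof -
    have "strat_space A = (\<Inter>i. (\<Inter>j\<in>A i. {p. 0 \<le> p $ (i,j)}) \<inter> {p. (\<Sum>j\<in>A i. p $ (i,j)) = 1}
        \<inter> (\<Inter>j\<in>- A i. {p. p $ (i,j) = 0}))"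
      by (auto simp: strat_space_def)
    then show ?thesis
      by (simp only:) (intro closed_INT closed_Int ballI closed_Collect_le closed_Collect_eq continuous_intros)
  qed
qed

section \<open>Pure deviations and advantages\<close>

text \<open>The vector \<open>axis (i, j) 1\<close> need not be a profile, but
  \<open>block_upd\<close> reads only its block \<open>i\<close>.\<close>

definition vertex :: "'n \<Rightarrow> 'a \<Rightarrow> ('n::finite,'a::finite) profile \<Rightarrow> ('n,'a) profile" where
  "vertex i j p = block_upd i (axis (i, j) 1) p"

lemma vertex_nth: "vertex i j p $ (k, l) = (if k = i then if l = j then 1 else 0 else p $ (k, l))"
  by (auto simp: vertex_def block_upd_def axis_def)

lemma block_upd_in:
  assumes "p \<in> strat_space A" "q \<in> strat_space A"
  shows "block_upd i p q \<in> strat_space A"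
proof -
  have "(\<Sum>j\<in>A k. block_upd i p q $ (k, j)) = 1" for k
    using assms by (cases "k = i") (auto simp: strat_space_def block_upd_def)
  then show ?thesis using assms by (auto simp: strat_space_def block_upd_def)
qed

lemma vertex_in:
  assumes "p \<in> strat_space A" "j \<in> A i"
  shows "vertex i j p \<in> strat_space A"
proof -
  have "(\<Sum>l\<in>A k. vertex i j p $ (k, l)) = 1" for k
    using assms by (cases "k = i") (auto simp: strat_space_def vertex_nth)
  then show ?thesis using assms by (auto simp: strat_space_def vertex_nth)
qed

lemma sum_Sigma_UNIV:
  fixes A :: "'n::finite \<Rightarrow> 'a::finite set"
  shows "(\<Sum>e\<in>Sigma UNIV A. h e) = (\<Sum>i\<in>UNIV. \<Sum>j\<in>A i. h (i, j))"
  by (subst sum.Sigma) auto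

definition advantage ::
  "('n::finite \<Rightarrow> 'a::finite set) \<Rightarrow> ('n \<Rightarrow> ('n,'a) profile \<Rightarrow> ('n,'a) profile) \<Rightarrow> 'n \<times> 'a \<Rightarrow> ('n,'a) profile \<Rightarrow> real" where
  "advantage A g e p = g (fst e) p $ e - (\<Sum>l\<in>A (fst e). g (fst e) p $ (fst e, l) * p $ (fst e, l))"

text \<open>The block of \<open>q\<close> has total mass 1, so the subtracted mean payoff is counted
  exactly once.\<close>

lemma sum_advantage:
  assumes p: "p \<in> strat_space A" and q: "q \<in> strat_space A"
  shows "(\<Sum>j\<in>A i. q $ (i, j) * advantage A g (i, j) p)
       = (\<Sum>j\<in>A i. g i p $ (i, j) * (q $ (i, j) - p $ (i, j)))"
proof -
  have "(\<Sum>j\<in>A i. q $ (i, j) * advantage A g (i, j) p)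
      = (\<Sum>j\<in>A i. g i p $ (i, j) * q $ (i, j))
        - (\<Sum>j\<in>A i. q $ (i, j)) * (\<Sum>l\<in>A i. g i p $ (i, l) * p $ (i, l))"
    unfolding sum_distrib_right[of _ "A i"] sum_subtractf[symmetric] advantage_def
    by (simp add: algebra_simps)
  also have "(\<Sum>j\<in>A i. q $ (i, j)) = 1" using q by (simp add: strat_space_def)
  finally show ?thesis by (simp add: right_diff_distrib sum_subtractf)
qed

lemma inner_block:
  fixes A :: "'n::finite \<Rightarrow> 'a::finite set"
  assumes "p \<in> strat_space A" "q \<in> strat_space A"
    and agree: "\<And>k l. k \<noteq> i \<Longrightarrow> q $ (k, l) = p $ (k, l)"
  shows "h \<bullet> (q - p) = (\<Sum>j\<in>A i. h $ (i, j) * (q $ (i, j) - p $ (i, j)))"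
proof -
  have "h \<bullet> (q - p) = (\<Sum>e\<in>UNIV. h $ e * (q $ e - p $ e))" by (simp add: inner_vec_def)
  also have "\<dots> = (\<Sum>e\<in>Pair i ` A i. h $ e * (q $ e - p $ e))"
  proof (intro sum.mono_neutral_right ballI)
    fix e assume "e \<in> UNIV - Pair i ` A i"
    moreover obtain k l where e: "e = (k, l)" by fastforce
    ultimately have "k \<noteq> i \<or> l \<notin> A i" by auto
    then have "q $ (k, l) = p $ (k, l)"
      using agree assms(1,2) by (cases "k = i") (auto simp: strat_space_def)
    then show "h $ e * (q $ e - p $ e) = 0" by (simp add: e)
  qed auto
  also have "\<dots> = (\<Sum>j\<in>A i. h $ (i, j) * (q $ (i, j) - p $ (i, j)))"
    by (subst sum.reindex) (auto simp: inj_on_def)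
  finally show ?thesis .
qed

locale monotone_game =
  fixes A :: "'n::finite \<Rightarrow> 'a::finite set"
    and v :: "'n \<Rightarrow> ('n,'a) profile \<Rightarrow> real"
    and g :: "'n \<Rightarrow> ('n,'a) profile \<Rightarrow> ('n,'a) profile"
  assumes diff: "\<And>i p. p \<in> strat_space A \<Longrightarrow>
                 (v i has_derivative (\<lambda>h. g i p \<bullet> h)) (at p within strat_space A)"
    and monotone: "\<And>p q. p \<in> strat_space A \<Longrightarrow> q \<in> strat_space A \<Longrightarrow>
                 (\<Sum>i\<in>UNIV. \<Sum>j\<in>A i. (g i p $ (i,j) - g i q $ (i,j)) * (p $ (i,j) - q $ (i,j))) \<le> 0"
begin

abbreviation "X \<equiv> strat_space A"

lemma segment_in: "p \<in> X \<Longrightarrow> q \<in> X \<Longrightarrow> 0 \<le> t \<Longrightarrow> t \<le> 1 \<Longrightarrow> p + t *\<^sub>R (q - p) \<in> X"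
  using convexD_alt[OF convex_strat_space, of p A q t] by (simp add: algebra_simps)

lemma continuous_on_v: "continuous_on X (v i)"
  by (rule has_derivative_continuous_on[OF diff])

section \<open>Concavity in the own strategy and its consequences\<close>

lemma segment_derivative:
  assumes "p \<in> X" "q \<in> X" "0 \<le> t" "t \<le> 1"
  shows "((\<lambda>t. v i (p + t *\<^sub>R (q - p))) has_derivative (\<lambda>h. g i (p + t *\<^sub>R (q - p)) \<bullet> (h *\<^sub>R (q - p))))
           (at t within {0..1})"
proof -
  have "(\<lambda>t. p + t *\<^sub>R (q - p)) ` {0..1} \<subseteq> X" using segment_in assms by auto
  then have "(v i has_derivative (\<lambda>h. g i (p + t *\<^sub>R (q - p)) \<bullet> h))
      (at (p + t *\<^sub>R (q - p)) within (\<lambda>t. p + t *\<^sub>R (q - p)) ` {0..1})"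
    by (rule has_derivative_subset[OF diff[OF segment_in[OF assms]]])
  moreover have "((\<lambda>t. p + t *\<^sub>R (q - p)) has_derivative (\<lambda>h. h *\<^sub>R (q - p))) (at t within {0..1})"
    by (auto intro!: derivative_eq_intros)
  ultimately show ?thesis by (rule has_derivative_in_compose[rotated])
qed

text \<open>The mean value theorem expresses the increment by the gradient at some \<open>w\<close>
  on the segment. As \<open>w\<close> and \<open>p\<close> differ in block \<open>i\<close> only,
  the monotonicity sum has one term and shows that the slope at \<open>w\<close> is at most the
  slope at \<open>p\<close>.\<close>

lemma own_concave:
  assumes p: "p \<in> X" and q: "q \<in> X" and agree: "\<And>k l. k \<noteq> i \<Longrightarrow> q $ (k, l) = p $ (k, l)"
  shows "v i q - v i p \<le> g i p \<bullet> (q - p)"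
proof -
  obtain t where t: "t \<in> {0..1}" and
    eq: "v i (p + 1 *\<^sub>R (q - p)) - v i (p + 0 *\<^sub>R (q - p)) = g i (p + t *\<^sub>R (q - p)) \<bullet> ((1 - 0) *\<^sub>R (q - p))"
    using mvt_very_simple[OF zero_le_one segment_derivative[OF p q]] by blast
  define w where "w = p + t *\<^sub>R (q - p)"
  have w: "w \<in> X" unfolding w_def using t by (intro segment_in p q) auto
  have eq': "v i q - v i p = g i w \<bullet> (q - p)" using eq by (simp add: w_def)
  have "g i w \<bullet> (q - p) \<le> g i p \<bullet> (q - p)"
  proof (cases "t = 0")
    case False
    then have "0 < t" using t by simp
    have "(\<Sum>k\<in>UNIV. \<Sum>j\<in>A k. (g k w $ (k,j) - g k p $ (k,j)) * (w $ (k,j) - p $ (k,j)))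
        = (\<Sum>k\<in>{i}. \<Sum>j\<in>A k. (g k w $ (k,j) - g k p $ (k,j)) * (w $ (k,j) - p $ (k,j)))"
      using agree by (intro sum.mono_neutral_right) (auto simp: w_def)
    also have "\<dots> = t * (\<Sum>j\<in>A i. (g i w - g i p) $ (i,j) * (q $ (i,j) - p $ (i,j)))"
      by (simp add: w_def sum_distrib_left algebra_simps)
    also have "\<dots> = t * ((g i w - g i p) \<bullet> (q - p))"
      using inner_block[OF p q agree] by simp
    finally have "t * ((g i w - g i p) \<bullet> (q - p)) \<le> 0" using monotone[OF w p] by simp
    then show ?thesis using \<open>0 < t\<close> by (simp add: mult_le_0_iff inner_diff_left)
  qed (simp add: w_def)
  then show ?thesis using eq' by simp
qed

lemma inner_vertex:
  assumes p: "p \<in> X" and j: "j \<in> A i"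
  shows "g i p \<bullet> (vertex i j p - p) = advantage A g (i, j) p"
proof -
  have "g i p \<bullet> (vertex i j p - p) = (\<Sum>l\<in>A i. g i p $ (i, l) * (vertex i j p $ (i, l) - p $ (i, l)))"
    by (rule inner_block[OF p vertex_in[where i = i and j = j and A = A, OF p j]]) (auto simp: vertex_nth)
  also have "\<dots> = (\<Sum>l\<in>A i. vertex i j p $ (i, l) * advantage A g (i, l) p)"
    by (rule sum_advantage[OF p vertex_in[where i = i and j = j and A = A, OF p j], symmetric])
  also have "\<dots> = (\<Sum>l\<in>A i. if l = j then advantage A g (i, l) p else 0)"
    by (intro sum.cong) (auto simp: vertex_nth)
  also have "\<dots> = advantage A g (i, j) p" using j by simp
  finally show ?thesis .
qed

lemma vertex_quotient_tendsto:
  assumes p: "p \<in> X" and j: "j \<in> A i"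
  shows "((\<lambda>t. (v i (p + t *\<^sub>R (vertex i j p - p)) - v i p) / t) \<longlongrightarrow> advantage A g (i, j) p) (at_right 0)"
proof -
  have "((\<lambda>t. v i (p + t *\<^sub>R (vertex i j p - p))) has_real_derivative advantage A g (i, j) p) (at 0 within {0..1})"
    using segment_derivative[OF p vertex_in[OF p j], of 0 i] inner_vertex[OF p j]
    by (simp add: has_field_derivative_def mult_commute_abs)
  then show ?thesis
    by (simp add: has_field_derivative_iff at_within_Icc_at_right)
qed

lemma vertex_quotient_le:
  assumes p: "p \<in> X" and j: "j \<in> A i" and t: "0 < t" "t \<le> 1"
  shows "(v i (p + t *\<^sub>R (vertex i j p - p)) - v i p) / t \<le> advantage A g (i, j) p"
proof -
  have "v i (p + t *\<^sub>R (vertex i j p - p)) - v i p \<le> g i p \<bullet> (p + t *\<^sub>R (vertex i j p - p) - p)"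
    by (rule own_concave) (use segment_in[OF p vertex_in[OF p j]] t p in \<open>auto simp: vertex_nth\<close>)
  also have "\<dots> = t * advantage A g (i, j) p" using inner_vertex[OF p j] by simp
  finally show ?thesis using t(1) by (simp only: pos_divide_le_eq mult.commute)
qed

text \<open>By concavity the advantage is the supremum over step lengths \<open>t\<close> of
  difference quotients of \<open>v i\<close>, each continuous in the profile; such a supremum is
  lower semicontinuous.\<close>

lemma advantage_lsc:
  assumes p: "p \<in> X" and j: "j \<in> A i" and \<epsilon>: "0 < \<epsilon>"
  shows "\<exists>d>0. \<forall>q\<in>X. dist q p < d \<longrightarrow> advantage A g (i, j) p - \<epsilon> \<le> advantage A g (i, j) q"
proof -
  define F where "F = (\<lambda>t q. (v i (q + t *\<^sub>R (vertex i j q - q)) - v i q) / t)"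
  have "\<forall>\<^sub>F t in at_right 0. advantage A g (i, j) p - \<epsilon> < F t p"
    using order_tendstoD(1)[OF vertex_quotient_tendsto[OF p j]] \<epsilon> by (simp add: F_def)
  moreover have "\<forall>\<^sub>F t in at_right 0. 0 < t \<and> t < (1::real)"
    by (auto simp: eventually_at_right_field intro!: exI[of _ 1])
  ultimately have "\<forall>\<^sub>F t in at_right 0. advantage A g (i, j) p - \<epsilon> < F t p \<and> 0 < t \<and> t < 1"
    by (rule eventually_conj)
  then obtain t where t: "advantage A g (i, j) p - \<epsilon> < F t p" "0 < t" "t < 1"
    using eventually_happens[of _ "at_right (0::real)"] trivial_limit_at_right_real by blast
  have "continuous_on X (vertex i j)"
    unfolding vertex_def block_upd_def
  proof (intro continuous_on_vec_lambda)
    fix k :: "'n \<times> 'a"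
    show "continuous_on X (\<lambda>x. if fst k = i then axis (i, j) 1 $ k else x $ k)"
      by (cases "fst k = i") (auto intro!: continuous_intros)
  qed
  then have "continuous_on X (\<lambda>q. q + t *\<^sub>R (vertex i j q - q))" by (intro continuous_intros)
  then have "continuous_on X (\<lambda>q. v i (q + t *\<^sub>R (vertex i j q - q)))"
    by (rule continuous_on_compose2[OF continuous_on_v]) (use segment_in[OF _ vertex_in[of _ A, OF _ j]] t in auto)
  then have cont: "continuous_on X (F t)"
    unfolding F_def using t by (intro continuous_intros continuous_on_v) auto
  have "0 < F t p - (advantage A g (i, j) p - \<epsilon>)" using t by simp
  then obtain d where d: "d > 0" "\<And>q. q \<in> X \<Longrightarrow> dist q p < d \<Longrightarrow>
      dist (F t q) (F t p) < F t p - (advantage A g (i, j) p - \<epsilon>)"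
    using cont p unfolding continuous_on_iff by blast
  have "advantage A g (i, j) p - \<epsilon> \<le> advantage A g (i, j) q" if "q \<in> X" "dist q p < d" for q
    using d(2)[OF that] vertex_quotient_le[OF that(1) j, of t] t(2,3)
    unfolding F_def dist_real_def by linarith
  with d(1) show ?thesis by blast
qed

text \<open>The difference quotient with \<open>t = 1\<close> bounds the advantage from below by a
  difference of two payoffs, and payoffs are bounded on a compact set.\<close>

lemma advantage_bounded_below:
  obtains L where "0 \<le> L" "\<And>i j p. p \<in> X \<Longrightarrow> j \<in> A i \<Longrightarrow> - L \<le> advantage A g (i, j) p"
proof -
  have "\<exists>b. \<forall>p\<in>X. \<bar>v i p\<bar> \<le> b" for i
    using compact_imp_bounded[OF compact_continuous_image[OF continuous_on_v compact_strat_space]]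
    unfolding bounded_iff by force
  then obtain b where b: "\<And>i p. p \<in> X \<Longrightarrow> \<bar>v i p\<bar> \<le> b i" by metis
  have le: "\<bar>v i p\<bar> \<le> (\<Sum>k\<in>UNIV. \<bar>b k\<bar>)" if "p \<in> X" for i p
    using b[OF that, of i] member_le_sum[of i UNIV "\<lambda>k. \<bar>b k\<bar>"] by auto
  show ?thesis
  proof (rule that[of "2 * (\<Sum>k\<in>UNIV. \<bar>b k\<bar>)"])
    show "0 \<le> 2 * (\<Sum>k\<in>UNIV. \<bar>b k\<bar>)" by (simp add: sum_nonneg)
    fix i j p assume p: "p \<in> X" and j: "j \<in> A i"
    show "- (2 * (\<Sum>k\<in>UNIV. \<bar>b k\<bar>)) \<le> advantage A g (i, j) p"
      using vertex_quotient_le[OF p j, of 1] le[OF p, of i] le[OF vertex_in[OF p j], of i] by simp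
  qed
qed

text \<open>By concavity the gain from a deviation is at most the average of the advantages under
  the deviating mixture.\<close>

lemma nash_if_advantage_nonpos:
  assumes s: "s \<in> X" and le: "\<And>i j. j \<in> A i \<Longrightarrow> advantage A g (i, j) s \<le> 0"
  shows "s \<in> nash_equilibria A v"
  unfolding nash_equilibria_def
proof (intro CollectI conjI allI ballI s)
  fix i p assume p: "p \<in> X"
  let ?q = "block_upd i p s"
  have q: "?q \<in> X" by (rule block_upd_in[OF p s])
  have agree: "?q $ (k, l) = s $ (k, l)" if "k \<noteq> i" for k l using that by (simp add: block_upd_def)
  have "v i ?q - v i s \<le> g i s \<bullet> (?q - s)" by (rule own_concave[OF s q agree])
  also have "\<dots> = (\<Sum>j\<in>A i. ?q $ (i, j) * advantage A g (i, j) s)"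
    using inner_block[OF s q agree] sum_advantage[OF s q] by simp
  also have "\<dots> \<le> 0" by (intro sum_nonpos mult_nonneg_nonpos strat_space_nonneg[OF q] le)
  finally show "v i ?q \<le> v i s" by simp
qed

lemma advantage_monotone:
  assumes p: "p \<in> X" and q: "q \<in> X"
  shows "0 \<le> (\<Sum>e\<in>Sigma UNIV A. q $ e * advantage A g e p) + (\<Sum>e\<in>Sigma UNIV A. p $ e * advantage A g e q)"
proof -
  have "(\<Sum>e\<in>Sigma UNIV A. q $ e * advantage A g e p) + (\<Sum>e\<in>Sigma UNIV A. p $ e * advantage A g e q)
    = (\<Sum>i\<in>UNIV. (\<Sum>j\<in>A i. q $ (i, j) * advantage A g (i, j) p) + (\<Sum>j\<in>A i. p $ (i, j) * advantage A g (i, j) q))"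
    unfolding sum_Sigma_UNIV sum.distrib ..
  also have "\<dots> = - (\<Sum>i\<in>UNIV. \<Sum>j\<in>A i. (g i p $ (i,j) - g i q $ (i,j)) * (p $ (i,j) - q $ (i,j)))"
    unfolding sum_advantage[OF p q] sum_advantage[OF q p] sum.distrib[symmetric] sum_negf[symmetric]
    by (intro sum.cong refl) (simp add: algebra_simps)
  finally show ?thesis using monotone[OF p q] by simp
qed

end

section \<open>First-order conditions for the divergences\<close>

lemma vertex_direction_derivative:
  fixes \<psi> :: "'a \<Rightarrow> real \<Rightarrow> real"
  assumes B: "finite B" "j \<in> B"
    and der: "\<And>l. l \<in> B \<Longrightarrow> (\<psi> l has_real_derivative D l) (at (x l))"
  shows "((\<lambda>t. \<Sum>l\<in>B. \<psi> l (x l + t * ((if l = j then 1 else 0) - x l)))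
           has_real_derivative (D j - (\<Sum>l\<in>B. D l * x l))) (at 0)"
proof -
  have "((\<lambda>t. \<psi> l (x l + t * ((if l = j then 1 else 0) - x l)))
          has_real_derivative D l * ((if l = j then 1 else 0) - x l)) (at 0)" if l: "l \<in> B" for l
  proof -
    have "(\<psi> l has_real_derivative D l) (at (x l + 0 * ((if l = j then 1 else 0) - x l)))"
      using der[OF l] by simp
    moreover have "((\<lambda>t. x l + t * ((if l = j then 1 else 0) - x l))
        has_real_derivative ((if l = j then 1 else 0) - x l)) (at 0)"
      by (auto intro!: derivative_eq_intros)
    ultimately show ?thesis
      by (rule DERIV_chain2[where g = "\<lambda>t. x l + t * ((if l = j then 1 else 0) - x l)"])
  qed
  then have "((\<lambda>t. \<Sum>l\<in>B. \<psi> l (x l + t * ((if l = j then 1 else 0) - x l)))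
      has_real_derivative (\<Sum>l\<in>B. D l * ((if l = j then 1 else 0) - x l))) (at 0)"
    by (intro DERIV_sum)
  moreover have "(\<Sum>l\<in>B. D l * ((if l = j then 1 else 0) - x l)) = (\<Sum>l\<in>B. if l = j then D l else 0) - (\<Sum>l\<in>B. D l * x l)"
    unfolding sum_subtractf[symmetric] by (intro sum.cong) (auto simp: algebra_simps)
  moreover have "(\<Sum>l\<in>B. if l = j then D l else 0) = D j" using B by simp
  ultimately show ?thesis by simp
qed

lemma quotient_tendsto_at_right:
  fixes h :: "real \<Rightarrow> real"
  assumes "(h has_real_derivative D) (at 0)"
  shows "((\<lambda>t. (h t - h 0) / t) \<longlongrightarrow> D) (at_right 0)"
  using has_field_derivative_at_within[OF assms, of "{0<..}"] by (simp add: has_field_derivative_iff)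

lemma power_mean_entry:
  fixes x s \<alpha> :: real
  assumes "0 < x" "0 < s"
  shows "\<alpha> * x powr (\<alpha> - 1) * s powr (1 - \<alpha>) = \<alpha> * (s / x) powr (1 - \<alpha>)"
    and "\<alpha> * (s / x) powr (1 - \<alpha>) * x = \<alpha> * (x powr \<alpha> * s powr (1 - \<alpha>))"
proof -
  have 1: "(s / x) powr (1 - \<alpha>) = s powr (1 - \<alpha>) * x powr (\<alpha> - 1)"
    using assms by (simp add: powr_divide powr_diff field_simps)
  show "\<alpha> * x powr (\<alpha> - 1) * s powr (1 - \<alpha>) = \<alpha> * (s / x) powr (1 - \<alpha>)" unfolding 1 by simp
  have "x powr (\<alpha> - 1) * x = x powr \<alpha>" using assms by (simp add: powr_diff)
  then show "\<alpha> * (s / x) powr (1 - \<alpha>) * x = \<alpha> * (x powr \<alpha> * s powr (1 - \<alpha>))"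
    unfolding 1 by (metis mult.assoc mult.commute)
qed

section \<open>The affinity underlying the alpha- and Renyi divergences\<close>

text \<open>The Chernoff coefficient of order \<open>\<alpha>\<close>. The alpha-divergence is
  affine in it, and the Renyi divergence is a multiple of its logarithm.\<close>

definition affinity :: "real \<Rightarrow> 'a set \<Rightarrow> ('a \<Rightarrow> real) \<Rightarrow> ('a \<Rightarrow> real) \<Rightarrow> real" where
  "affinity \<alpha> B x s = (\<Sum>j\<in>B. x j powr \<alpha> * s j powr (1 - \<alpha>))"

lemma affinity_le_1:
  assumes "0 < \<alpha>" "\<alpha> < 1" "\<And>l. l \<in> B \<Longrightarrow> 0 < x l" "\<And>l. l \<in> B \<Longrightarrow> 0 < s l"
    and "sum x B = 1" "sum s B = 1"
  shows "affinity \<alpha> B x s \<le> 1"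
proof -
  have "affinity \<alpha> B x s \<le> (\<Sum>l\<in>B. \<alpha> * x l + (1 - \<alpha>) * s l)"
    unfolding affinity_def using assms by (intro sum_mono Youngs_inequality_0) auto
  also have "\<dots> = \<alpha> * sum x B + (1 - \<alpha>) * sum s B" by (simp add: sum.distrib sum_distrib_left)
  finally show ?thesis using assms by simp
qed

lemma affinity_derivative:
  assumes "finite B" "j \<in> B" and x: "\<And>l. l \<in> B \<Longrightarrow> 0 < x l" and s: "\<And>l. l \<in> B \<Longrightarrow> 0 < s l"
  shows "((\<lambda>t. affinity \<alpha> B (\<lambda>l. x l + t * ((if l = j then 1 else 0) - x l)) s)
           has_real_derivative \<alpha> * ((s j / x j) powr (1 - \<alpha>) - affinity \<alpha> B x s)) (at 0)"
proof -
  have "((\<lambda>t. affinity \<alpha> B (\<lambda>l. x l + t * ((if l = j then 1 else 0) - x l)) s)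
      has_real_derivative \<alpha> * (s j / x j) powr (1 - \<alpha>) - (\<Sum>l\<in>B. \<alpha> * (s l / x l) powr (1 - \<alpha>) * x l)) (at 0)"
    unfolding affinity_def
  proof (rule vertex_direction_derivative[OF assms(1,2)])
    fix l assume l: "l \<in> B"
    have "((\<lambda>y. y powr \<alpha> * s l powr (1 - \<alpha>)) has_real_derivative \<alpha> * x l powr (\<alpha> - 1) * s l powr (1 - \<alpha>)) (at (x l))"
      using x[OF l] by (intro DERIV_cmult_right has_real_derivative_powr)
    then show "((\<lambda>y. y powr \<alpha> * s l powr (1 - \<alpha>)) has_real_derivative \<alpha> * (s l / x l) powr (1 - \<alpha>)) (at (x l))"
      unfolding power_mean_entry(1)[OF x[OF l] s[OF l]] .
  qed
  \<comment> \<open>Euler's identity: the affinity is homogeneous of degree \<open>\<alpha>\<close>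
    in \<open>x\<close>.\<close>
  moreover have "(\<Sum>l\<in>B. \<alpha> * (s l / x l) powr (1 - \<alpha>) * x l) = \<alpha> * affinity \<alpha> B x s"
    unfolding affinity_def sum_distrib_left
    by (intro sum.cong refl power_mean_entry(2) x s)
  ultimately show ?thesis by (simp add: right_diff_distrib)
qed

text \<open>At a boundary point the affinity leaves with infinite slope, since \<open>t powr \<alpha>\<close> does.\<close>

lemma affinity_boundary:
  assumes "finite B" "j \<in> B" "0 < \<alpha>" "\<alpha> < 1" and x: "\<And>l. l \<in> B \<Longrightarrow> 0 \<le> x l"
    and "x j = 0" "0 < s j"
  defines "h \<equiv> \<lambda>t. affinity \<alpha> B (\<lambda>l. x l + t * ((if l = j then 1 else 0) - x l)) s"
  shows "filterlim (\<lambda>t. (h t - h 0) / t) at_top (at_right 0)" and "(h \<longlongrightarrow> h 0) (at_right 0)"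
proof -
  define w where "w = s j powr (1 - \<alpha>)"
  have w: "0 < w" using assms by (simp add: w_def)
  have h0: "h 0 = affinity \<alpha> B x s" by (simp add: h_def)
  have h0_nonneg: "0 \<le> h 0" unfolding h0 affinity_def by (intro sum_nonneg) auto
  \<comment> \<open>Since \<open>x j = 0\<close>, moving towards vertex \<open>j\<close> scales
    every other coordinate by \<open>1 - t\<close> and sets coordinate \<open>j\<close> to
    \<open>t\<close>.\<close>
  have h_eq: "h t = (1 - t) powr \<alpha> * h 0 + t powr \<alpha> * w" if "0 < t" "t < 1" for t
  proof -
    have "h t = t powr \<alpha> * w + (\<Sum>l\<in>B - {j}. ((1 - t) * x l) powr \<alpha> * s l powr (1 - \<alpha>))"
      unfolding h_def affinity_def using assms(1,2,6)
      by (subst sum.remove[of _ j]) (auto simp: w_def algebra_simps intro!: sum.cong)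
    also have "(\<Sum>l\<in>B - {j}. ((1 - t) * x l) powr \<alpha> * s l powr (1 - \<alpha>))
        = (1 - t) powr \<alpha> * (\<Sum>l\<in>B - {j}. x l powr \<alpha> * s l powr (1 - \<alpha>))"
      unfolding sum_distrib_left using that x by (intro sum.cong) (auto simp: powr_mult)
    also have "(\<Sum>l\<in>B - {j}. x l powr \<alpha> * s l powr (1 - \<alpha>)) = h 0"
      unfolding h0 affinity_def using assms(1,2,6) by (subst sum.remove[of B j]) auto
    finally show ?thesis by simp
  qed
  have ev: "\<forall>\<^sub>F t in at_right 0. 0 < t \<and> t < (1::real)"
    by (auto simp: eventually_at_right_field intro!: exI[of _ 1])
  have powr_0: "((\<lambda>t::real. t powr b) \<longlongrightarrow> 0) (at_right 0)" if "0 < b" for b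
    by (rule tendsto_zero_powrI[OF tendsto_ident_at tendsto_const])
       (use that in \<open>auto simp: eventually_at_right_field intro!: exI[of _ 1]\<close>)
  have "filterlim (\<lambda>t::real. inverse (t powr (1 - \<alpha>))) at_top (at_right 0)"
    by (rule filterlim_inverse_at_top[OF powr_0])
       (use assms(4) in \<open>auto simp: eventually_at_right_field intro!: exI[of _ 1]\<close>)
  then have "filterlim (\<lambda>t::real. w * t powr (\<alpha> - 1)) at_top (at_right 0)"
    using filterlim_tendsto_pos_mult_at_top[OF tendsto_const w] by (simp add: powr_minus[symmetric])
  from filterlim_tendsto_add_at_top[OF tendsto_const this, of "- h 0"]
  have "filterlim (\<lambda>t. - h 0 + t powr (\<alpha> - 1) * w) at_top (at_right 0)"
    by (simp add: mult.commute)
  then show "filterlim (\<lambda>t. (h t - h 0) / t) at_top (at_right 0)"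
  proof (rule filterlim_at_top_mono)
    \<comment> \<open>Replacing \<open>(1 - t) powr \<alpha>\<close> by the smaller
      \<open>1 - t\<close> leaves an explicit lower bound for the quotient, dominated by
      \<open>t powr (\<alpha> - 1)\<close>.\<close>
    show "\<forall>\<^sub>F t in at_right 0. - h 0 + t powr (\<alpha> - 1) * w \<le> (h t - h 0) / t"
      using ev
    proof (rule eventually_mono)
      fix t :: real assume t: "0 < t \<and> t < 1"
      have "(1 - t) powr 1 \<le> (1 - t) powr \<alpha>"
        using t assms(3,4) by (intro powr_mono') auto
      then have "(1 - t) * h 0 \<le> (1 - t) powr \<alpha> * h 0"
        using t h0_nonneg by (intro mult_right_mono) auto
      then have "- t * h 0 + t powr \<alpha> * w \<le> h t - h 0"
        using h_eq[of t] t by (simp add: algebra_simps)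
      then have "(- t * h 0 + t powr \<alpha> * w) / t \<le> (h t - h 0) / t"
        using t by (intro divide_right_mono) auto
      moreover have "(- t * h 0 + t powr \<alpha> * w) / t = - h 0 + t powr (\<alpha> - 1) * w"
        using t by (simp add: powr_diff field_simps)
      ultimately show "- h 0 + t powr (\<alpha> - 1) * w \<le> (h t - h 0) / t" by simp
    qed
  qed
  have "((\<lambda>t. (1 - t) powr \<alpha> * h 0 + t powr \<alpha> * w) \<longlongrightarrow> h 0) (at_right 0)"
  proof -
    have "((\<lambda>t. (1 - t) powr \<alpha> * h 0 + t powr \<alpha> * w) \<longlongrightarrow> (1 - 0) powr \<alpha> * h 0 + 0 * w) (at_right 0)"
      using assms(3) by (intro tendsto_intros powr_0) auto
    then show ?thesis by simp
  qed
  then show "(h \<longlongrightarrow> h 0) (at_right 0)"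
    by (rule Lim_transform_eventually) (use ev h_eq in \<open>auto elim!: eventually_mono\<close>)
qed

lemma strat_interior_subset: "p \<in> strat_interior A \<Longrightarrow> p \<in> strat_space A"
  by (simp add: strat_interior_def)

section \<open>Optimality conditions for perturbed equilibria\<close>

context monotone_game begin

definition towards :: "'n \<Rightarrow> 'a \<Rightarrow> ('n,'a) profile \<Rightarrow> real \<Rightarrow> ('n,'a) profile" where
  "towards i j p t = p + t *\<^sub>R (vertex i j p - p)"

lemma towards_in: "p \<in> X \<Longrightarrow> j \<in> A i \<Longrightarrow> 0 < t \<Longrightarrow> t < 1 \<Longrightarrow> towards i j p t \<in> X"
  unfolding towards_def by (intro segment_in vertex_in) auto

lemma block_upd_towards: "block_upd i (towards i j p t) p = towards i j p t"
  by (auto simp: vec_eq_iff block_upd_def towards_def vertex_nth)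

lemma block_towards: "block (towards i j p t) i = (\<lambda>l. block p i l + t * ((if l = j then 1 else 0) - block p i l))"
  by (auto simp: block_def towards_def vertex_nth)

lemma sum_block: "p \<in> X \<Longrightarrow> sum (block p i) (A i) = 1"
  by (simp add: strat_space_def block_def)

lemma perturbed_eqD:
  assumes "perturbed_eq A v G \<mu> \<sigma> \<pi>" "j \<in> A i" "0 < t" "t < 1"
  shows "ereal (v i (towards i j \<pi> t)) - ereal \<mu> * G (A i) (block (towards i j \<pi> t) i) (block \<sigma> i)
        \<le> ereal (v i \<pi>) - ereal \<mu> * G (A i) (block \<pi> i) (block \<sigma> i)"
proof -
  have "\<pi> \<in> X" using assms(1) by (simp add: perturbed_eq_def)
  then have "towards i j \<pi> t \<in> X" using towards_in assms by blast
  then show ?thesis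
    using assms(1) block_upd_towards[of i j \<pi> t] unfolding perturbed_eq_def by metis
qed

text \<open>Here \<open>- C * h\<close> stands for the penalty up to a constant. Payoff quotients
  towards a vertex converge to the finite advantage and are dominated by \<open>- C\<close> times
  the quotients of \<open>h\<close>: the limits compare, and an infinite slope of \<open>h\<close>
  is impossible. The second conclusion will exclude boundary points.\<close>

lemma one_sided_first_order:
  assumes p: "p \<in> X" and j: "j \<in> A i" and C: "0 < C"
    and le: "\<And>t. 0 < t \<Longrightarrow> t < 1 \<Longrightarrow> v i (towards i j p t) - v i p \<le> - C * (h t - h 0)"
  shows "((\<lambda>t. (h t - h 0) / t) \<longlongrightarrow> D) (at_right 0) \<Longrightarrow> advantage A g (i, j) p \<le> - C * D"
    and "\<not> filterlim (\<lambda>t. (h t - h 0) / t) at_top (at_right 0)"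
proof -
  have ev: "\<forall>\<^sub>F t in at_right 0. (v i (towards i j p t) - v i p) / t \<le> - C * ((h t - h 0) / t)"
  proof -
    have "\<forall>\<^sub>F t in at_right 0. 0 < t \<and> t < (1::real)"
      by (auto simp: eventually_at_right_field intro!: exI[of _ 1])
    then show ?thesis
    proof (rule eventually_mono)
      fix t :: real assume t: "0 < t \<and> t < 1"
      then have "(v i (towards i j p t) - v i p) / t \<le> (- C * (h t - h 0)) / t"
        using le by (intro divide_right_mono) auto
      then show "(v i (towards i j p t) - v i p) / t \<le> - C * ((h t - h 0) / t)" by simp
    qed
  qed
  note lim = vertex_quotient_tendsto[OF p j, folded towards_def]
  show "advantage A g (i, j) p \<le> - C * D" if "((\<lambda>t. (h t - h 0) / t) \<longlongrightarrow> D) (at_right 0)"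
    by (rule tendsto_le[OF trivial_limit_at_right_real tendsto_mult[OF tendsto_const that] lim ev])
  show "\<not> filterlim (\<lambda>t. (h t - h 0) / t) at_top (at_right 0)"
  proof
    assume top: "filterlim (\<lambda>t. (h t - h 0) / t) at_top (at_right 0)"
    have "\<forall>\<^sub>F t in at_right 0. advantage A g (i, j) p - 1 < (v i (towards i j p t) - v i p) / t"
      using lim by (rule order_tendstoD) simp
    moreover have "\<forall>\<^sub>F t in at_right 0. (1 - advantage A g (i, j) p) / C \<le> (h t - h 0) / t"
      using top unfolding filterlim_at_top by blast
    ultimately have "\<forall>\<^sub>F t in at_right (0::real). False"
      using ev
    proof eventually_elim
      case (elim t)
      have "C * ((1 - advantage A g (i, j) p) / C) \<le> C * ((h t - h 0) / t)"
        using elim(2) C by (intro mult_left_mono) auto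
      then show ?case using elim(1,3) C by simp
    qed
    then show False by (simp add: eventually_False)
  qed
qed

text \<open>A zero coordinate would give the affinity infinite slope, which optimality forbids. In
  the interior the first-order condition bounds the ratio term by the affinity minus a multiple of
  the advantage, and the affinity is at most 1.\<close>

lemma alpha_div_step:
  assumes \<alpha>: "0 < \<alpha>" "\<alpha> < 1" and \<mu>: "0 < \<mu>" and \<sigma>: "\<sigma> \<in> strat_interior A"
    and eq: "perturbed_eq A v (alpha_div \<alpha>) \<mu> \<sigma> \<pi>"
  shows "\<pi> \<in> strat_interior A"
    and "j \<in> A i \<Longrightarrow> (\<sigma> $ (i,j) / \<pi> $ (i,j)) powr (1 - \<alpha>) \<le> 1 - (1 - \<alpha>) / \<mu> * advantage A g (i,j) \<pi>"
proof -
  have \<pi>: "\<pi> \<in> X" using eq by (simp add: perturbed_eq_def)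
  have \<sigma>_pos: "0 < block \<sigma> i j" if "j \<in> A i" for i j using \<sigma> that by (simp add: strat_interior_def block_def)
  define h where "h = (\<lambda>i j t. affinity \<alpha> (A i) (\<lambda>l. block \<pi> i l + t * ((if l = j then 1 else 0) - block \<pi> i l)) (block \<sigma> i))"
  define C where "C = \<mu> / (\<alpha> * (1 - \<alpha>))"
  have C: "0 < C" using \<alpha> \<mu> by (simp add: C_def)
  have opt: "v i (towards i j \<pi> t) - v i \<pi> \<le> - C * (h i j t - h i j 0)"
    if "j \<in> A i" "0 < t" "t < 1" for i j t
  proof -
    have "alpha_div \<alpha> (A i) (block (towards i j \<pi> t) i) (block \<sigma> i) = ereal (1 / (\<alpha> * (1 - \<alpha>)) * (1 - h i j t))"
      by (simp add: alpha_div_def block_towards h_def affinity_def)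
    moreover have "alpha_div \<alpha> (A i) (block \<pi> i) (block \<sigma> i) = ereal (1 / (\<alpha> * (1 - \<alpha>)) * (1 - h i j 0))"
      by (simp add: alpha_div_def h_def affinity_def)
    ultimately have le: "v i (towards i j \<pi> t) - \<mu> * (1 / (\<alpha> * (1 - \<alpha>)) * (1 - h i j t))
        \<le> v i \<pi> - \<mu> * (1 / (\<alpha> * (1 - \<alpha>)) * (1 - h i j 0))"
      using perturbed_eqD[OF eq that] by simp
    have "\<mu> * (1 / (\<alpha> * (1 - \<alpha>)) * y) = C * y" for y by (simp add: C_def)
    from le[unfolded this] show ?thesis by (simp add: algebra_simps)
  qed
  have pos: "0 < block \<pi> i j" if j: "j \<in> A i" for i j
  proof (rule ccontr)
    assume "\<not> 0 < block \<pi> i j"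
    then have zero: "block \<pi> i j = 0" using strat_space_nonneg[OF \<pi>, of "(i, j)"] by (simp add: block_def)
    have "filterlim (\<lambda>t. (h i j t - h i j 0) / t) at_top (at_right 0)"
      unfolding h_def
      by (rule affinity_boundary(1)) (use j \<alpha> zero \<sigma>_pos strat_space_nonneg[OF \<pi>] in \<open>auto simp: block_def\<close>)
    then show False using one_sided_first_order(2)[OF \<pi> j C opt[OF j]] by blast
  qed
  show "\<pi> \<in> strat_interior A" using \<pi> pos by (auto simp: strat_interior_def block_def)
  assume j: "j \<in> A i"
  let ?S = "affinity \<alpha> (A i) (block \<pi> i) (block \<sigma> i)"
  have "(h i j has_real_derivative \<alpha> * ((block \<sigma> i j / block \<pi> i j) powr (1 - \<alpha>) - ?S)) (at 0)"
    unfolding h_def by (rule affinity_derivative) (use j pos \<sigma>_pos in auto)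
  then have "advantage A g (i, j) \<pi> \<le> - C * (\<alpha> * ((block \<sigma> i j / block \<pi> i j) powr (1 - \<alpha>) - ?S))"
    by (intro one_sided_first_order(1)[OF \<pi> j C opt[OF j]] quotient_tendsto_at_right)
  moreover have "- C * (\<alpha> * ((block \<sigma> i j / block \<pi> i j) powr (1 - \<alpha>) - ?S))
      = \<mu> / (1 - \<alpha>) * (?S - (block \<sigma> i j / block \<pi> i j) powr (1 - \<alpha>))"
    using \<alpha> by (simp add: C_def field_simps)
  ultimately have "(1 - \<alpha>) / \<mu> * advantage A g (i, j) \<pi>
      \<le> (1 - \<alpha>) / \<mu> * (\<mu> / (1 - \<alpha>) * (?S - (block \<sigma> i j / block \<pi> i j) powr (1 - \<alpha>)))"
    using \<alpha> \<mu> by (intro mult_left_mono) auto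
  also have "\<dots> = ?S - (block \<sigma> i j / block \<pi> i j) powr (1 - \<alpha>)" using \<alpha> \<mu> by simp
  also have "?S \<le> 1"
    using \<alpha> pos \<sigma>_pos sum_block[OF \<pi>] sum_block[OF strat_interior_subset[OF \<sigma>]] by (intro affinity_le_1) auto
  finally show "(\<sigma> $ (i,j) / \<pi> $ (i,j)) powr (1 - \<alpha>) \<le> 1 - (1 - \<alpha>) / \<mu> * advantage A g (i,j) \<pi>"
    by (simp add: block_def)
qed

text \<open>Deviating to the block of \<open>\<sigma>\<close> costs no penalty and has a finite
  objective, so an infinite penalty cannot be optimal.\<close>

lemma perturbed_eq_finite:
  assumes eq: "perturbed_eq A v G \<mu> \<sigma> \<pi>" and \<sigma>: "\<sigma> \<in> X" and \<mu>: "0 < \<mu>"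
    and fin: "G (A i) (block \<sigma> i) (block \<sigma> i) = 0"
  shows "G (A i) (block \<pi> i) (block \<sigma> i) \<noteq> \<infinity>"
proof
  assume inf: "G (A i) (block \<pi> i) (block \<sigma> i) = \<infinity>"
  have "ereal (v i (block_upd i \<sigma> \<pi>)) - ereal \<mu> * G (A i) (block \<sigma> i) (block \<sigma> i)
      \<le> ereal (v i \<pi>) - ereal \<mu> * G (A i) (block \<pi> i) (block \<sigma> i)"
    using eq \<sigma> unfolding perturbed_eq_def by blast
  then show False using inf fin \<mu> by simp
qed

lemma renyi_div_step:
  assumes \<alpha>: "0 < \<alpha>" "\<alpha> < 1" and \<mu>: "0 < \<mu>" and \<sigma>: "\<sigma> \<in> strat_interior A"
    and eq: "perturbed_eq A v (renyi_div \<alpha>) \<mu> \<sigma> \<pi>"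
  shows "\<pi> \<in> strat_interior A"
    and "j \<in> A i \<Longrightarrow> (\<sigma> $ (i,j) / \<pi> $ (i,j)) powr (1 - \<alpha>) \<le> 1 - (1 - \<alpha>) / (\<mu> * \<alpha>) * advantage A g (i,j) \<pi>"
proof -
  have \<pi>: "\<pi> \<in> X" using eq by (simp add: perturbed_eq_def)
  have \<sigma>_pos: "0 < block \<sigma> i j" if "j \<in> A i" for i j using \<sigma> that by (simp add: strat_interior_def block_def)
  define S where "S = (\<lambda>i j t. affinity \<alpha> (A i) (\<lambda>l. block \<pi> i l + t * ((if l = j then 1 else 0) - block \<pi> i l)) (block \<sigma> i))"
  define h where "h = (\<lambda>i j t. ln (S i j t))"
  define C where "C = \<mu> / (1 - \<alpha>)"
  have C: "0 < C" using \<alpha> \<mu> by (simp add: C_def)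
  have S0: "S i j 0 = affinity \<alpha> (A i) (block \<pi> i) (block \<sigma> i)" for i j by (simp add: S_def)
  have S_nonneg: "0 \<le> S i j t" for i j t unfolding S_def affinity_def by (intro sum_nonneg) auto
  have S0_pos: "0 < S i j 0" for i j
  proof -
    have "block \<sigma> i l powr \<alpha> * block \<sigma> i l powr (1 - \<alpha>) = block \<sigma> i l" if "l \<in> A i" for l
      using \<sigma>_pos[OF that] by (simp add: powr_add[symmetric])
    then have "(\<Sum>l\<in>A i. block \<sigma> i l powr \<alpha> * block \<sigma> i l powr (1 - \<alpha>)) = 1"
      using sum_block[OF strat_interior_subset[OF \<sigma>], of i] by simp
    then have "renyi_div \<alpha> (A i) (block \<sigma> i) (block \<sigma> i) = 0" by (simp add: renyi_div_def)
    then have "renyi_div \<alpha> (A i) (block \<pi> i) (block \<sigma> i) \<noteq> \<infinity>"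
      by (rule perturbed_eq_finite[where G = "renyi_div \<alpha>", OF eq strat_interior_subset[OF \<sigma>] \<mu>])
    then have "S i j 0 \<noteq> 0" unfolding S0 by (auto simp: renyi_div_def affinity_def)
    then show ?thesis using S_nonneg[of i j 0] by simp
  qed
  \<comment> \<open>Some action has positive weight, and it keeps the fraction \<open>1 - t\<close>
    of it on the way to the vertex; hence the divergence is finite along the segment.\<close>
  have S_pos: "0 < S i j t" if "j \<in> A i" "0 < t" "t < 1" for i j t
  proof -
    obtain l where l: "l \<in> A i" "0 < block \<pi> i l"
      using sum_block[OF \<pi>, of i] strat_space_nonneg[OF \<pi>]
      by (metis block_def not_less_iff_gr_or_eq order_le_less sum.neutral zero_neq_one)
    have "block \<pi> i l + t * ((if l = j then 1 else 0) - block \<pi> i l)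
        = (1 - t) * block \<pi> i l + t * (if l = j then 1 else 0)" by (simp add: algebra_simps)
    also have "\<dots> > 0" using l that by (intro add_pos_nonneg) auto
    finally have "0 < (block \<pi> i l + t * ((if l = j then 1 else 0) - block \<pi> i l)) powr \<alpha> * block \<sigma> i l powr (1 - \<alpha>)"
      using \<sigma>_pos[OF l(1)] by simp
    then show ?thesis unfolding S_def affinity_def using l(1) by (intro sum_pos2[of _ l]) auto
  qed
  have opt: "v i (towards i j \<pi> t) - v i \<pi> \<le> - C * (h i j t - h i j 0)"
    if "j \<in> A i" "0 < t" "t < 1" for i j t
  proof -
    have "renyi_div \<alpha> (A i) (block (towards i j \<pi> t) i) (block \<sigma> i) = ereal (1 / (\<alpha> - 1) * h i j t)"
      using S_pos[OF that] by (simp add: renyi_div_def Let_def block_towards h_def S_def affinity_def)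
    moreover have "renyi_div \<alpha> (A i) (block \<pi> i) (block \<sigma> i) = ereal (1 / (\<alpha> - 1) * h i j 0)"
      using S0_pos[of i j] by (simp add: renyi_div_def Let_def h_def S_def affinity_def)
    ultimately have le: "v i (towards i j \<pi> t) - \<mu> * (1 / (\<alpha> - 1) * h i j t) \<le> v i \<pi> - \<mu> * (1 / (\<alpha> - 1) * h i j 0)"
      using perturbed_eqD[OF eq that] by simp
    have "\<mu> * (1 / (\<alpha> - 1) * y) = - C * y" for y
      using \<alpha> by (simp add: C_def divide_simps) (simp add: algebra_simps)
    from le[unfolded this] show ?thesis by (simp add: algebra_simps)
  qed
  have pos: "0 < block \<pi> i j" if j: "j \<in> A i" for i j
  proof (rule ccontr)
    assume "\<not> 0 < block \<pi> i j"
    then have zero: "block \<pi> i j = 0" using strat_space_nonneg[OF \<pi>, of "(i, j)"] by (simp add: block_def)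
    have top: "filterlim (\<lambda>t. (S i j t - S i j 0) / t) at_top (at_right 0)"
      and lim: "(S i j \<longlongrightarrow> S i j 0) (at_right 0)"
      unfolding S_def
      by (rule affinity_boundary[where x = "block \<pi> i"]; use j \<alpha> zero \<sigma>_pos strat_space_nonneg[OF \<pi>] in \<open>auto simp: block_def\<close>)+
    have "((\<lambda>t. 1 / S i j t) \<longlongrightarrow> 1 / S i j 0) (at_right 0)"
      using lim S0_pos[of i j] by (intro tendsto_intros) auto
    from filterlim_tendsto_pos_mult_at_top[OF this _ top]
    have "filterlim (\<lambda>t. 1 / S i j t * ((S i j t - S i j 0) / t)) at_top (at_right 0)"
      using S0_pos[of i j] by simp
    then have "filterlim (\<lambda>t. (h i j t - h i j 0) / t) at_top (at_right 0)"
    proof (rule filterlim_at_top_mono)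
      have "\<forall>\<^sub>F t in at_right 0. 0 < t \<and> t < (1::real)"
        by (auto simp: eventually_at_right_field intro!: exI[of _ 1])
      then show "\<forall>\<^sub>F t in at_right 0. 1 / S i j t * ((S i j t - S i j 0) / t) \<le> (h i j t - h i j 0) / t"
      proof (rule eventually_mono)
        fix t :: real assume t: "0 < t \<and> t < 1"
        then have St: "0 < S i j t" using S_pos[OF j] by simp
        \<comment> \<open>The bound \<open>ln y \<le> y - 1\<close> compares the increment of
          \<open>ln S\<close> with that of \<open>S\<close>, so the infinite slope passes through
          the logarithm.\<close>
        have "ln (S i j 0 / S i j t) \<le> S i j 0 / S i j t - 1"
          using St S0_pos[of i j] by (intro ln_le_minus_one) simp
        then have "(S i j t - S i j 0) / S i j t \<le> h i j t - h i j 0"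
          using St S0_pos[of i j] by (simp add: h_def ln_div diff_divide_distrib)
        then have "(S i j t - S i j 0) / S i j t / t \<le> (h i j t - h i j 0) / t"
          using t by (intro divide_right_mono) auto
        then show "1 / S i j t * ((S i j t - S i j 0) / t) \<le> (h i j t - h i j 0) / t" by simp
      qed
    qed
    then show False using one_sided_first_order(2)[OF \<pi> j C opt[OF j]] by blast
  qed
  show "\<pi> \<in> strat_interior A" using \<pi> pos by (auto simp: strat_interior_def block_def)
  assume j: "j \<in> A i"
  let ?r = "(block \<sigma> i j / block \<pi> i j) powr (1 - \<alpha>)"
  have "(S i j has_real_derivative \<alpha> * (?r - S i j 0)) (at 0)"
    unfolding S0 unfolding S_def by (rule affinity_derivative) (use j pos \<sigma>_pos in auto)
  then have "(h i j has_real_derivative (1 / S i j 0) * (\<alpha> * (?r - S i j 0))) (at 0)"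
    unfolding h_def by (rule DERIV_chain2[where g = "S i j", OF DERIV_ln_divide[OF S0_pos]])
  then have "advantage A g (i, j) \<pi> \<le> - C * (1 / S i j 0 * (\<alpha> * (?r - S i j 0)))"
    by (intro one_sided_first_order(1)[OF \<pi> j C opt[OF j]] quotient_tendsto_at_right)
  also have "\<dots> = \<mu> * \<alpha> / (1 - \<alpha>) * (1 - ?r / S i j 0)"
  proof -
    have "1 / S i j 0 * (\<alpha> * (?r - S i j 0)) = - (\<alpha> * (1 - ?r / S i j 0))"
      using S0_pos[of i j] by (simp add: field_simps)
    then show ?thesis by (simp add: C_def)
  qed
  finally have "(1 - \<alpha>) / (\<mu> * \<alpha>) * advantage A g (i, j) \<pi>
      \<le> (1 - \<alpha>) / (\<mu> * \<alpha>) * (\<mu> * \<alpha> / (1 - \<alpha>) * (1 - ?r / S i j 0))"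
    using \<alpha> \<mu> by (intro mult_left_mono) auto
  also have "\<dots> = 1 - ?r / S i j 0" using \<alpha> \<mu> by simp
  finally have 1: "?r / S i j 0 \<le> 1 - (1 - \<alpha>) / (\<mu> * \<alpha>) * advantage A g (i, j) \<pi>" by simp
  have "S i j 0 \<le> 1" unfolding S0
    using \<alpha> pos \<sigma>_pos sum_block[OF \<pi>] sum_block[OF strat_interior_subset[OF \<sigma>]] by (intro affinity_le_1) auto
  \<comment> \<open>The first-order condition bounds \<open>?r / S\<close>; as \<open>S\<close> is
    at most 1, \<open>?r\<close> itself is no larger.\<close>
  then have "?r * S i j 0 \<le> ?r * 1" by (intro mult_left_mono) auto
  then have "?r \<le> ?r / S i j 0" using S0_pos[of i j] by (simp add: pos_le_divide_eq)
  with 1 show "(\<sigma> $ (i,j) / \<pi> $ (i,j)) powr (1 - \<alpha>) \<le> 1 - (1 - \<alpha>) / (\<mu> * \<alpha>) * advantage A g (i,j) \<pi>"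
    by (simp add: block_def)
qed

text \<open>The penalty is infinite on the boundary because \<open>\<sigma>\<close> is positive, so
  interiority is immediate. The derivative of the negated penalty towards vertex \<open>j\<close> is
  the ratio minus 1, since the weights of \<open>\<sigma>\<close> sum to 1 in each block.\<close>

lemma rev_KL_step:
  assumes \<mu>: "0 < \<mu>" and \<sigma>: "\<sigma> \<in> strat_interior A" and eq: "perturbed_eq A v rev_KL \<mu> \<sigma> \<pi>"
  shows "\<pi> \<in> strat_interior A"
    and "j \<in> A i \<Longrightarrow> \<sigma> $ (i,j) / \<pi> $ (i,j) \<le> 1 - 1 / \<mu> * advantage A g (i,j) \<pi>"
proof -
  have \<pi>: "\<pi> \<in> X" using eq by (simp add: perturbed_eq_def)
  have \<sigma>_pos: "0 < block \<sigma> i j" if "j \<in> A i" for i j using \<sigma> that by (simp add: strat_interior_def block_def)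
  have pos: "0 < block \<pi> i j" if j: "j \<in> A i" for i j
  proof -
    have "block \<sigma> i l \<noteq> 0" if "l \<in> A i" for l using \<sigma>_pos[OF that] by simp
    then have "rev_KL (A i) (block \<sigma> i) (block \<sigma> i) = 0"
      by (auto simp: rev_KL_def intro!: sum.neutral)
    then have "rev_KL (A i) (block \<pi> i) (block \<sigma> i) \<noteq> \<infinity>"
      by (rule perturbed_eq_finite[where G = rev_KL, OF eq strat_interior_subset[OF \<sigma>] \<mu>])
    then have "block \<pi> i j \<noteq> 0" using j \<sigma>_pos[OF j] by (auto simp: rev_KL_def split: if_splits)
    then show ?thesis using strat_space_nonneg[OF \<pi>, of "(i, j)"] by (simp add: block_def)
  qed
  show "\<pi> \<in> strat_interior A" using \<pi> pos by (auto simp: strat_interior_def block_def)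
  assume j: "j \<in> A i"
  define h where "h = (\<lambda>t. \<Sum>l\<in>A i. - (block \<sigma> i l * ln (block \<sigma> i l / (block \<pi> i l + t * ((if l = j then 1 else 0) - block \<pi> i l)))))"
  have opt: "v i (towards i j \<pi> t) - v i \<pi> \<le> - \<mu> * (h t - h 0)" if t: "0 < t" "t < 1" for t
  proof -
    have "block (towards i j \<pi> t) i l \<noteq> 0" if "l \<in> A i" for l
    proof -
      have "block (towards i j \<pi> t) i l = (1 - t) * block \<pi> i l + t * (if l = j then 1 else 0)"
        by (simp add: block_towards algebra_simps)
      also have "\<dots> > 0" using pos[OF that] t by (intro add_pos_nonneg) auto
      finally show ?thesis by simp
    qed
    then have "rev_KL (A i) (block (towards i j \<pi> t) i) (block \<sigma> i) = ereal (- h t)"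
      by (simp add: rev_KL_def h_def block_towards sum_negf)
    moreover have "rev_KL (A i) (block \<pi> i) (block \<sigma> i) = ereal (- h 0)"
      using pos by (force simp: rev_KL_def h_def sum_negf)
    ultimately show ?thesis using perturbed_eqD[OF eq j t] by (simp add: algebra_simps)
  qed
  have "(h has_real_derivative block \<sigma> i j / block \<pi> i j - (\<Sum>l\<in>A i. block \<sigma> i l / block \<pi> i l * block \<pi> i l)) (at 0)"
    unfolding h_def
  proof (rule vertex_direction_derivative[where \<psi> = "\<lambda>l y. - (block \<sigma> i l * ln (block \<sigma> i l / y))"])
    fix l assume l: "l \<in> A i"
    show "((\<lambda>y. - (block \<sigma> i l * ln (block \<sigma> i l / y))) has_real_derivative block \<sigma> i l / block \<pi> i l) (at (block \<pi> i l))"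
      using pos[OF l] \<sigma>_pos[OF l] by (auto intro!: derivative_eq_intros simp: field_simps)
  qed (use j in auto)
  moreover have "(\<Sum>l\<in>A i. block \<sigma> i l / block \<pi> i l * block \<pi> i l) = (\<Sum>l\<in>A i. block \<sigma> i l)"
    using pos by (intro sum.cong) force+
  moreover have "(\<Sum>l\<in>A i. block \<sigma> i l) = 1" using sum_block[OF strat_interior_subset[OF \<sigma>]] .
  ultimately have "(h has_real_derivative block \<sigma> i j / block \<pi> i j - 1) (at 0)" by simp
  then have "advantage A g (i, j) \<pi> \<le> - \<mu> * (block \<sigma> i j / block \<pi> i j - 1)"
    by (intro one_sided_first_order(1)[OF \<pi> j \<mu> opt] quotient_tendsto_at_right)
  then show "\<sigma> $ (i,j) / \<pi> $ (i,j) \<le> 1 - 1 / \<mu> * advantage A g (i,j) \<pi>"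
    using \<mu> by (simp add: block_def field_simps)
qed

end

section \<open>Convergence to equilibrium\<close>

text \<open>Gibbs' inequality: \<open>ln y \<le> y - 1\<close> bounds each term below by the
  difference of the weights, and these differences sum to 0. It keeps the infimum over equilibria
  bounded below.\<close>

lemma KL_nonneg:
  assumes p: "p \<in> strat_space A" and q: "q \<in> strat_interior A"
  shows "0 \<le> KL A p q"
proof -
  have qX: "q \<in> strat_space A" by (rule strat_interior_subset[OF q])
  have "p $ (i,j) - q $ (i,j) \<le> p $ (i,j) * ln (p $ (i,j) / q $ (i,j))" if j: "j \<in> A i" for i j
  proof (cases "p $ (i,j) = 0")
    case True
    then show ?thesis using strat_space_nonneg[OF qX, of "(i,j)"] by simp
  next
    case False
    then have pos: "0 < p $ (i,j)" using strat_space_nonneg[OF p, of "(i,j)"] by simp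
    have q_pos: "0 < q $ (i,j)" using q j by (simp add: strat_interior_def)
    have "ln (q $ (i,j) / p $ (i,j)) \<le> q $ (i,j) / p $ (i,j) - 1"
      using pos q_pos by (intro ln_le_minus_one) simp
    then have "p $ (i,j) * (1 - q $ (i,j) / p $ (i,j)) \<le> p $ (i,j) * ln (p $ (i,j) / q $ (i,j))"
      using pos q_pos by (intro mult_left_mono) (auto simp: ln_div)
    moreover have "p $ (i,j) * (1 - q $ (i,j) / p $ (i,j)) = p $ (i,j) - q $ (i,j)"
      using pos by (simp add: right_diff_distrib)
    ultimately show ?thesis by simp
  qed
  then have "(\<Sum>i\<in>UNIV. \<Sum>j\<in>A i. p $ (i,j) - q $ (i,j)) \<le> KL A p q"
    unfolding KL_def by (intro sum_mono)
  moreover have "(\<Sum>i\<in>UNIV. \<Sum>j\<in>A i. p $ (i,j) - q $ (i,j)) = 0"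
    using p qX by (simp add: strat_space_def sum_subtractf)
  ultimately show ?thesis by simp
qed

text \<open>The limit is the first argument, so coordinates where it vanishes contribute 0 even if
  it lies on the boundary.\<close>

lemma KL_tendsto_0:
  assumes lim: "\<sigma> \<longlonglongrightarrow> s"
  shows "(\<lambda>k. KL A s (\<sigma> k)) \<longlonglongrightarrow> 0"
proof -
  have "(\<lambda>k. s $ e * ln (s $ e / \<sigma> k $ e)) \<longlonglongrightarrow> 0" for e
  proof (cases "s $ e = 0")
    case False
    then have "(\<lambda>k. s $ e * ln (s $ e / \<sigma> k $ e)) \<longlonglongrightarrow> s $ e * ln (s $ e / s $ e)"
      by (intro tendsto_intros lim) auto
    then show ?thesis using False by simp
  qed simp
  then have "(\<lambda>k. KL A s (\<sigma> k)) \<longlonglongrightarrow> (\<Sum>i\<in>UNIV. \<Sum>j\<in>A i. 0)"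
    unfolding KL_def by (intro tendsto_sum)
  then show ?thesis by simp
qed

context monotone_game begin

lemma perturbed_step:
  assumes G: "(\<exists>\<alpha>. 0 < \<alpha> \<and> \<alpha> < 1 \<and> G = alpha_div \<alpha>)
            \<or> (\<exists>\<alpha>. 0 < \<alpha> \<and> \<alpha> < 1 \<and> G = renyi_div \<alpha>) \<or> G = rev_KL"
    and \<mu>: "0 < \<mu>"
  obtains \<beta> \<kappa> where "0 < \<beta>" "0 < \<kappa>"
    "\<And>\<sigma> \<pi>. \<sigma> \<in> strat_interior A \<Longrightarrow> perturbed_eq A v G \<mu> \<sigma> \<pi> \<Longrightarrow> \<pi> \<in> strat_interior A"
    "\<And>\<sigma> \<pi> i j. \<sigma> \<in> strat_interior A \<Longrightarrow> perturbed_eq A v G \<mu> \<sigma> \<pi> \<Longrightarrow> j \<in> A i \<Longrightarrow>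
       (\<sigma> $ (i,j) / \<pi> $ (i,j)) powr \<beta> \<le> 1 - \<kappa> * advantage A g (i,j) \<pi>"
  using G
proof (elim disjE exE conjE)
  fix \<alpha> assume \<alpha>: "0 < \<alpha>" "\<alpha> < 1" and G: "G = alpha_div \<alpha>"
  show thesis
    by (rule that[of "1 - \<alpha>" "(1 - \<alpha>) / \<mu>"]) (use alpha_div_step[OF \<alpha> \<mu>] \<alpha> \<mu> G in auto)
next
  fix \<alpha> assume \<alpha>: "0 < \<alpha>" "\<alpha> < 1" and G: "G = renyi_div \<alpha>"
  show thesis
    by (rule that[of "1 - \<alpha>" "(1 - \<alpha>) / (\<mu> * \<alpha>)"]) (use renyi_div_step[OF \<alpha> \<mu>] \<alpha> \<mu> G in auto)
next
  assume G: "G = rev_KL"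
  show thesis
  proof (rule that[of 1 "1 / \<mu>"])
    fix \<sigma> \<pi> assume \<sigma>: "\<sigma> \<in> strat_interior A" and eq: "perturbed_eq A v G \<mu> \<sigma> \<pi>"
    note step = rev_KL_step[OF \<mu> \<sigma> eq[unfolded G]]
    show "\<pi> \<in> strat_interior A" by (rule step(1))
    fix i j assume j: "j \<in> A i"
    have "0 < \<sigma> $ (i,j) / \<pi> $ (i,j)" using \<sigma> step(1) j by (simp add: strat_interior_def)
    then show "(\<sigma> $ (i,j) / \<pi> $ (i,j)) powr 1 \<le> 1 - 1 / \<mu> * advantage A g (i,j) \<pi>"
      using step(2)[OF j] by simp
  qed (use \<mu> in auto)
qed

end

theorem theorem9:
  fixes A :: "'n::finite \<Rightarrow> 'a::finite set"
    and v :: "'n \<Rightarrow> ('n,'a) profile \<Rightarrow> real"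
    and g :: "'n \<Rightarrow> ('n,'a) profile \<Rightarrow> ('n,'a) profile"
    and G :: "'a set \<Rightarrow> ('a \<Rightarrow> real) \<Rightarrow> ('a \<Rightarrow> real) \<Rightarrow> ereal"
    and \<mu> :: real
    and \<sigma> :: "nat \<Rightarrow> ('n,'a) profile"
  assumes A_ne: "\<And>i. A i \<noteq> {}"
    and diff: "\<And>i \<pi>. \<pi> \<in> strat_space A \<Longrightarrow>
                 (v i has_derivative (\<lambda>h. g i \<pi> \<bullet> h)) (at \<pi> within strat_space A)"
    and monotone: "\<And>\<pi> \<pi>'. \<pi> \<in> strat_space A \<Longrightarrow> \<pi>' \<in> strat_space A \<Longrightarrow>
                 (\<Sum>i\<in>UNIV. \<Sum>j\<in>A i. (g i \<pi> $ (i,j) - g i \<pi>' $ (i,j)) * (\<pi> $ (i,j) - \<pi>' $ (i,j))) \<le> 0"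
    and G_choice: "(\<exists>\<alpha>. 0 < \<alpha> \<and> \<alpha> < 1 \<and> G = alpha_div \<alpha>)
                 \<or> (\<exists>\<alpha>. 0 < \<alpha> \<and> \<alpha> < 1 \<and> G = renyi_div \<alpha>)
                 \<or> G = rev_KL"
    and mu_pos: "0 < \<mu>"
    and init: "\<sigma> 0 \<in> strat_interior A"
    and step: "\<And>k. perturbed_eq A v G \<mu> (\<sigma> k) (\<sigma> (Suc k))"
  shows "(\<lambda>k. INF p\<in>nash_equilibria A v. KL A p (\<sigma> k)) \<longlonglongrightarrow> 0"
proof -
  interpret monotone_game A v g using diff monotone by unfold_locales
  obtain \<beta> \<kappa> where \<beta>: "0 < \<beta>" and \<kappa>: "0 < \<kappa>"
    and interior_step: "\<And>\<sigma> \<pi>. \<sigma> \<in> strat_interior A \<Longrightarrow> perturbed_eq A v G \<mu> \<sigma> \<pi> \<Longrightarrow> \<pi> \<in> strat_interior A"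
    and ratio: "\<And>\<sigma> \<pi> i j. \<sigma> \<in> strat_interior A \<Longrightarrow> perturbed_eq A v G \<mu> \<sigma> \<pi> \<Longrightarrow> j \<in> A i \<Longrightarrow>
       (\<sigma> $ (i,j) / \<pi> $ (i,j)) powr \<beta> \<le> 1 - \<kappa> * advantage A g (i,j) \<pi>"
    using perturbed_step[OF G_choice mu_pos] by metis
  have interior: "\<sigma> k \<in> strat_interior A" for k
    by (induction k) (use init interior_step step in auto)
  have \<sigma>_pos: "0 < \<sigma> k $ (i,j)" if "j \<in> A i" for k i j
    using interior[of k] that by (simp add: strat_interior_def)
  obtain L where L: "0 \<le> L" "\<And>i j p. p \<in> X \<Longrightarrow> j \<in> A i \<Longrightarrow> - L \<le> advantage A g (i, j) p"
    using advantage_bounded_below by blast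
  \<comment> \<open>This is the quadratic coefficient of \<open>neg_ln_ge_quadratic\<close> at
    \<open>\<kappa> * x\<close> with lower bound \<open>- (\<kappa> * L)\<close>, divided by the
    exponent \<open>\<beta>\<close>.\<close>
  define c where "c = \<kappa>\<^sup>2 / (2 * (1 + \<kappa> * L)) / \<beta>"
  have growth: "\<kappa> / \<beta> * advantage A g (i,j) (\<sigma> (Suc k)) + c * (advantage A g (i,j) (\<sigma> (Suc k)))\<^sup>2
      \<le> ln (\<sigma> (Suc k) $ (i,j)) - ln (\<sigma> k $ (i,j))" if j: "j \<in> A i" for i j k
  proof -
    define x where "x = advantage A g (i,j) (\<sigma> (Suc k))"
    have r: "(\<sigma> k $ (i,j) / \<sigma> (Suc k) $ (i,j)) powr \<beta> \<le> 1 - \<kappa> * x"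
      unfolding x_def by (rule ratio[OF interior step j])
    have r_pos: "0 < (\<sigma> k $ (i,j) / \<sigma> (Suc k) $ (i,j)) powr \<beta>"
      using \<sigma>_pos[OF j, of k] \<sigma>_pos[OF j, of "Suc k"] by simp
    have "- L \<le> x" unfolding x_def by (rule L(2)[OF strat_interior_subset[OF interior] j])
    then have "- (\<kappa> * L) \<le> \<kappa> * x" using \<kappa> by (metis mult_left_mono less_imp_le mult_minus_right)
    then have "\<kappa> * x + (\<kappa> * x)\<^sup>2 / (2 * (1 + \<kappa> * L)) \<le> - ln (1 - \<kappa> * x)"
      using \<kappa> L(1) less_le_trans[OF r_pos r] by (intro neg_ln_ge_quadratic) auto
    also have "\<dots> \<le> - ln ((\<sigma> k $ (i,j) / \<sigma> (Suc k) $ (i,j)) powr \<beta>)"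
      using ln_mono[OF r r_pos] by simp
    also have "\<dots> = \<beta> * (ln (\<sigma> (Suc k) $ (i,j)) - ln (\<sigma> k $ (i,j)))"
      using \<sigma>_pos[OF j, of k] \<sigma>_pos[OF j, of "Suc k"] by (simp add: ln_powr ln_div algebra_simps)
    finally have "(\<kappa> * x + (\<kappa> * x)\<^sup>2 / (2 * (1 + \<kappa> * L))) / \<beta> \<le> ln (\<sigma> (Suc k) $ (i,j)) - ln (\<sigma> k $ (i,j))"
      using \<beta> by (simp add: pos_divide_le_eq mult.commute)
    moreover have "(\<kappa> * x + (\<kappa> * x)\<^sup>2 / (2 * (1 + \<kappa> * L))) / \<beta> = \<kappa> / \<beta> * x + c * x\<^sup>2"
      by (simp add: c_def add_divide_distrib power_mult_distrib)
    ultimately show ?thesis by (simp add: x_def)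
  qed
  interpret replicator_growth "Sigma UNIV A" X "advantage A g" \<sigma> "\<kappa> / \<beta>" c "real CARD('n)"
  proof unfold_locales
    fix p assume p: "p \<in> X"
    show "(\<Sum>e\<in>Sigma UNIV A. p $ e) = real CARD('n)"
      unfolding sum_Sigma_UNIV using p by (simp add: strat_space_def)
    show "(\<Sum>e\<in>Sigma UNIV A. p $ e * advantage A g e p) = 0"
      unfolding sum_Sigma_UNIV sum_advantage[OF p p] by simp
    fix e :: "'n \<times> 'a"
    show "p $ e = 0" if "e \<notin> Sigma UNIV A" using p that by (cases e) (auto simp: strat_space_def)
    fix \<epsilon> :: real assume "e \<in> Sigma UNIV A" "0 < \<epsilon>"
    then show "\<exists>d>0. \<forall>q\<in>X. dist q p < d \<longrightarrow> advantage A g e p - \<epsilon> \<le> advantage A g e q"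
      using advantage_lsc[OF p] by (cases e) auto
  next
    show "0 < \<kappa> / \<beta>" "0 < c" using \<beta> \<kappa> L(1) by (auto simp: c_def intro!: divide_pos_pos mult_pos_pos add_pos_nonneg)
  qed (use compact_strat_space convex_strat_space strat_space_nonneg strat_space_le_1 advantage_monotone
         strat_interior_subset[OF interior] \<sigma>_pos growth in auto)
  obtain s where s: "s \<in> X" "\<sigma> \<longlonglongrightarrow> s" "\<And>e. e \<in> Sigma UNIV A \<Longrightarrow> advantage A g e s \<le> 0"
    using converges_to_rest_point by blast
  have nash: "s \<in> nash_equilibria A v" by (rule nash_if_advantage_nonpos) (use s in auto)
  have nonneg: "0 \<le> KL A p (\<sigma> k)" if "p \<in> nash_equilibria A v" for p k
    using that KL_nonneg[OF _ interior] by (auto simp: nash_equilibria_def)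
  \<comment> \<open>The infimum lies between 0 and its value at the limit \<open>s\<close>, which is
    itself an equilibrium.\<close>
  show ?thesis
  proof (rule tendsto_sandwich[OF _ _ tendsto_const KL_tendsto_0[OF s(2)]])
    show "\<forall>\<^sub>F k in sequentially. 0 \<le> (INF p\<in>nash_equilibria A v. KL A p (\<sigma> k))"
      using nash nonneg by (intro always_eventually allI cINF_greatest) auto
    show "\<forall>\<^sub>F k in sequentially. (INF p\<in>nash_equilibria A v. KL A p (\<sigma> k)) \<le> KL A s (\<sigma> k)"
      using nash nonneg by (intro always_eventually allI cINF_lower bdd_belowI2[where m = 0]) auto
  qed
qed

end
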